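(* Let $K$ be a pathwise connected poset and let $\mathcal{X}=(X,p,J,K)$ be a net bundle of topological spaces whose fibre is an arcwise connected, Hausdorff, locally arcwise and simply connected space $M$. Let $\mathcal{X}_\prec=(X_\prec,p_\prec,J,K)$ be the poset net bundle associated with $\mathcal{X}$, and put $\eta=p_\prec$. Then for each $a\in K$ (and $U\in X_{\prec,a}$) there is an exact sequence $$\pi_1(M)\xrightarrow{\,j_a\,}\pi_1(X_\prec,U)\xrightarrow{\,\eta_*\,}\pi_1(K,a)\to\mathbf{0},$$ where $\pi_1(M)$ is the topological fundamental group and the other two groups are homotopy groups of posets.
   Context: Homotopy of a poset $K$: a $1$-simplex $b=(|b|;\partial_0b,\partial_1b)$ consists of elements of $K$ with $\partial_0b,\partial_1b\leq|b|$. A $2$-simplex $c$ consists of $1$-simplices $\partial_0c,\partial_1c,\partial_2c$ and $|c|\in K$ with $|\partial_ic|\leq|c|$, satisfying $\partial_0\partial_1c=\partial_0\partial_0c$, $\partial_0\partial_2c=\partial_1\partial_0c$, $\partial_1\partial_2c=\partial_1\partial_1c$. A path is $p=b_n*\cdots*b_1$ with $\partial_0b_i=\partial_1b_{i+1}$, going from $\partial_1b_1$ to $\partial_0b_n$. $K$ is pathwise connected if any two elements are joined by a path. Homotopy of paths is generated by replacing a $1$-simplex $\partial_1c$ of a path by $\partial_0c*\partial_2c$, or conversely. $\pi_1(K,a)$ is the group of homotopy classes of closed paths at $a$ under concatenation, with identity the class of $(a;a,a)$. Order-preserving maps induce homomorphisms of $\pi_1$. Net bundle of topological spaces over $K$: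 $(X,p,J,K)$ with $p:X\to K$ surjective, each fibre $X_a=p^{-1}(a)$ a topological space, and homeomorphisms $J_{(a',a)}:X_a\to X_{a'}$ for $a\leq a'$ in $K$ with $J_{(a,a)}=\mathrm{id}$ and $J_{(a'',a')}J_{(a',a)}=J_{(a'',a)}$. All fibres are homeomorphic to the (standard) fibre $M$. Associated poset net bundle: for each $a\in K$ fix a poset $X_{\prec,a}$ of nonempty open subsets of $X_a$, ordered under inclusion and forming a base for the topology of $X_a$, such that $U\mapsto J_{(a',a)}(U)$ is a poset isomorphism $X_{\prec,a}\to X_{\prec,a'}$ for all $a\leq a'$. $X_\prec$ is the disjoint union of the $X_{\prec,a}$, with projection $p_\prec:X_\prec\to K$ and ordering: for $U_1\in X_{\prec,a_1}$, $U_0\in X_{\prec,a_0}$, $U_1\prec U_0$ iff $a_1\leq a_0$ and $J_{(a_0,a_1)}(U_1)\subseteq U_0$. The map $j_a$ is the homomorphism induced by the order-preserving inclusion $X_{\prec,a}\hookrightarrow X_\prec$, under the identification $\pi_1(M)\simeq\pi_1(X_{\prec,a},U)$.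
   Formalization: The open sets in each chosen base of a fibre are additionally assumed arcwise and simply connected; for arbitrary bases of nonempty open sets the identification of the fundamental group of M with that of the fibre poset, and exactness itself, can fail. *)

theory Defs
  imports "HOL-Analysis.Analysis" "HOL-Algebra.Elementary_Groups"
begin

text \<open>A poset is given by its order relation \<open>P\<close> with \<^term>\<open>Partial_order P\<close>;
  its set of elements is \<^term>\<open>Field P\<close>, and \<open>(x, y) \<in> P\<close> means \<open>x \<le> y\<close>.\<close>

datatype 'a simplex1 = Simplex1 (supp: 'a) (bd0: 'a) (bd1: 'a)

datatype 'a simplex2 =
  Simplex2 (supp2: 'a) (face0: "'a simplex1") (face1: "'a simplex1") (face2: "'a simplex1")

definition is_simplex1 :: "'a rel \<Rightarrow> 'a simplex1 \<Rightarrow> bool" where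
  "is_simplex1 P b \<longleftrightarrow> (bd0 b, supp b) \<in> P \<and> (bd1 b, supp b) \<in> P"

definition is_simplex2 :: "'a rel \<Rightarrow> 'a simplex2 \<Rightarrow> bool" where
  "is_simplex2 P c \<longleftrightarrow>
     (\<forall>b \<in> {face0 c, face1 c, face2 c}. is_simplex1 P b \<and> (supp b, supp2 c) \<in> P) \<and>
     bd0 (face1 c) = bd0 (face0 c) \<and>
     bd0 (face2 c) = bd1 (face0 c) \<and>
     bd1 (face2 c) = bd1 (face1 c)"

text \<open>The path \<open>b\<^sub>n * \<dots> * b\<^sub>1\<close>, which is traversed from right to left, is the nonempty list
  \<open>[b\<^sub>n, \<dots>, b\<^sub>1]\<close>; hence concatenation \<open>q * p\<close> (first \<open>p\<close>, then \<open>q\<close>) is \<open>q @ p\<close>.\<close>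

definition poset_path :: "'a rel \<Rightarrow> 'a simplex1 list \<Rightarrow> bool" where
  "poset_path P p \<longleftrightarrow>
     p \<noteq> [] \<and> (\<forall>b \<in> set p. is_simplex1 P b) \<and> successively (\<lambda>b' b. bd0 b = bd1 b') p"

definition poset_path_from_to :: "'a rel \<Rightarrow> 'a \<Rightarrow> 'a \<Rightarrow> 'a simplex1 list \<Rightarrow> bool" where
  "poset_path_from_to P x y p \<longleftrightarrow> poset_path P p \<and> bd1 (last p) = x \<and> bd0 (hd p) = y"

definition pathwise_connected_poset :: "'a rel \<Rightarrow> bool" where
  "pathwise_connected_poset P \<longleftrightarrow>
     (\<forall>x \<in> Field P. \<forall>y \<in> Field P. \<exists>p. poset_path_from_to P x y p)"

definition elementary_deformation ::
    "'a rel \<Rightarrow> 'a simplex1 list \<Rightarrow> 'a simplex1 list \<Rightarrow> bool" where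
  "elementary_deformation P p q \<longleftrightarrow>
     poset_path P p \<and> poset_path P q \<and>
     (\<exists>r s c. is_simplex2 P c \<and> p = r @ [face1 c] @ s \<and> q = r @ [face0 c, face2 c] @ s)"

definition poset_homotopy_class :: "'a rel \<Rightarrow> 'a simplex1 list \<Rightarrow> 'a simplex1 list set" where
  "poset_homotopy_class P p = {q. equivclp (elementary_deformation P) p q}"

definition poset_loops :: "'a rel \<Rightarrow> 'a \<Rightarrow> 'a simplex1 list set" where
  "poset_loops P a = {p. poset_path_from_to P a a p}"

definition poset_pi1 :: "'a rel \<Rightarrow> 'a \<Rightarrow> 'a simplex1 list set monoid" where
  "poset_pi1 P a =
     \<lparr>carrier = poset_homotopy_class P ` poset_loops P a,
      monoid.mult = (\<lambda>A B. \<Union>q\<in>A. \<Union>p\<in>B. poset_homotopy_class P (q @ p)),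
      one = poset_homotopy_class P [Simplex1 a a a]\<rparr>"

text \<open>The map induced by an order-preserving \<open>f\<close> into the poset \<open>Q\<close>. As in the multiplication
  above, the union is over a single value, because \<open>f\<close> preserves homotopy.\<close>

definition poset_pi1_map ::
    "'b rel \<Rightarrow> ('a \<Rightarrow> 'b) \<Rightarrow> 'a simplex1 list set \<Rightarrow> 'b simplex1 list set" where
  "poset_pi1_map Q f A = (\<Union>p\<in>A. poset_homotopy_class Q (map (map_simplex1 f) p))"

definition top_loops :: "'a topology \<Rightarrow> 'a \<Rightarrow> (real \<Rightarrow> 'a) set" where
  "top_loops X x = {g. pathin X g \<and> g 0 = x \<and> g 1 = x}"

definition top_homotopy_class :: "'a topology \<Rightarrow> 'a \<Rightarrow> (real \<Rightarrow> 'a) \<Rightarrow> (real \<Rightarrow> 'a) set" where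
  "top_homotopy_class X x g =
     {h. homotopic_with (\<lambda>r. r 0 = x \<and> r 1 = x) (top_of_set {0..1}) X g h}"

text \<open>Same as \<^const>\<open>joinpaths\<close>, whose type requires a topology given by a type class.\<close>

definition top_join :: "(real \<Rightarrow> 'a) \<Rightarrow> (real \<Rightarrow> 'a) \<Rightarrow> real \<Rightarrow> 'a" where
  "top_join g h = (\<lambda>t. if t \<le> 1 / 2 then g (2 * t) else h (2 * t - 1))"

text \<open>The product \<open>[h] [g]\<close> is the class of the loop running first through \<open>g\<close>, then through
  \<open>h\<close>, in agreement with \<^const>\<open>poset_pi1\<close>.\<close>

definition top_pi1 :: "'a topology \<Rightarrow> 'a \<Rightarrow> (real \<Rightarrow> 'a) set monoid" where
  "top_pi1 X x =
     \<lparr>carrier = top_homotopy_class X x ` top_loops X x,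
      monoid.mult = (\<lambda>A B. \<Union>h\<in>A. \<Union>g\<in>B. top_homotopy_class X x (top_join g h)),
      one = top_homotopy_class X x (\<lambda>_. x)\<rparr>"

definition simply_connected_space :: "'a topology \<Rightarrow> bool" where
  "simply_connected_space X \<longleftrightarrow>
     path_connected_space X \<and> (\<forall>x \<in> topspace X. trivial_group (top_pi1 X x))"

definition locally_simply_connected_space :: "'a topology \<Rightarrow> bool" where
  "locally_simply_connected_space X \<longleftrightarrow>
     neighbourhood_base_of
       (\<lambda>V. openin X V \<and> path_connectedin X V \<and> simply_connected_space (subtopology X V)) X"

text \<open>\<open>T a\<close> is the topology of the fibre over \<open>a\<close>, and \<open>J a' a\<close> is \<open>J\<^bsub>(a',a)\<^esub>\<close>.\<close>

locale net_bundle =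
  fixes K :: "'k rel" and X :: "'x set" and p :: "'x \<Rightarrow> 'k"
    and T :: "'k \<Rightarrow> 'x topology" and J :: "'k \<Rightarrow> 'k \<Rightarrow> 'x \<Rightarrow> 'x"
  assumes poset: "Partial_order K"
    and surj: "p ` X = Field K"
    and fibre: "\<And>a. a \<in> Field K \<Longrightarrow> topspace (T a) = {x \<in> X. p x = a}"
    and homeo: "\<And>a a'. (a, a') \<in> K \<Longrightarrow> homeomorphic_map (T a) (T a') (J a' a)"
    and J_refl: "\<And>a x. a \<in> Field K \<Longrightarrow> x \<in> topspace (T a) \<Longrightarrow> J a a x = x"
    and J_comp: "\<And>a a' a'' x. (a, a') \<in> K \<Longrightarrow> (a', a'') \<in> K \<Longrightarrow> x \<in> topspace (T a) \<Longrightarrow>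
                   J a'' a' (J a' a x) = J a'' a x"

text \<open>\<open>B a\<close> is the set of elements of \<open>X\<^bsub>\<prec>,a\<^esub>\<close>.\<close>

locale poset_net_bundle = net_bundle K X p T J
  for K :: "'k rel" and X :: "'x set" and p :: "'x \<Rightarrow> 'k"
    and T :: "'k \<Rightarrow> 'x topology" and J :: "'k \<Rightarrow> 'k \<Rightarrow> 'x \<Rightarrow> 'x" +
  fixes B :: "'k \<Rightarrow> 'x set set"
  assumes B_open: "\<And>a U. a \<in> Field K \<Longrightarrow> U \<in> B a \<Longrightarrow> openin (T a) U \<and> U \<noteq> {}"
    and B_base: "\<And>a W x. a \<in> Field K \<Longrightarrow> openin (T a) W \<Longrightarrow> x \<in> W \<Longrightarrow>
                   \<exists>U \<in> B a. x \<in> U \<and> U \<subseteq> W"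
    and B_bij: "\<And>a a'. (a, a') \<in> K \<Longrightarrow> bij_betw (\<lambda>U. J a' a ` U) (B a) (B a')"
    and B_order: "\<And>a a' U V. (a, a') \<in> K \<Longrightarrow> U \<in> B a \<Longrightarrow> V \<in> B a \<Longrightarrow>
                   J a' a ` U \<subseteq> J a' a ` V \<longleftrightarrow> U \<subseteq> V"

definition inclusion_order :: "'x set set \<Rightarrow> 'x set rel" where
  "inclusion_order C = {(U, V). U \<in> C \<and> V \<in> C \<and> U \<subseteq> V}"

text \<open>The poset \<open>X\<^sub>\<prec>\<close>: the element \<open>U\<close> of the summand \<open>X\<^bsub>\<prec>,a\<^esub>\<close> of the disjoint union is
  the pair \<open>(a, U)\<close>, so \<open>p\<^sub>\<prec>\<close> is \<^const>\<open>fst\<close>.\<close>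

definition bundle_order ::
    "'k rel \<Rightarrow> ('k \<Rightarrow> 'k \<Rightarrow> 'x \<Rightarrow> 'x) \<Rightarrow> ('k \<Rightarrow> 'x set set) \<Rightarrow> ('k \<times> 'x set) rel" where
  "bundle_order K J B =
     {((a1, U1), (a0, U0)). U1 \<in> B a1 \<and> U0 \<in> B a0 \<and> (a1, a0) \<in> K \<and> J a0 a1 ` U1 \<subseteq> U0}"

text \<open>The poset path \<open>q = b\<^sub>n * \<dots> * b\<^sub>1\<close> approximates the curve \<open>g\<close> if there is a subdivision
  \<open>0 = s\<^sub>0 < \<dots> < s\<^sub>n = 1\<close> such that \<open>b\<^sub>i\<close> covers the part of \<open>g\<close> over \<open>[s\<^bsub>i-1\<^esub>, s\<^sub>i]\<close>. This is
  how Ruzzi identifies the fundamental group of a space with that of a base of arcwise and simply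
  connected open sets.\<close>

definition approximates :: "'x set simplex1 list \<Rightarrow> (real \<Rightarrow> 'x) \<Rightarrow> bool" where
  "approximates q g \<longleftrightarrow>
     (\<exists>s :: nat \<Rightarrow> real. s 0 = 0 \<and> s (length q) = 1 \<and>
        (\<forall>i < length q. s i < s (Suc i) \<and>
           g ` {s i..s (Suc i)} \<subseteq> supp (rev q ! i) \<and>
           g (s i) \<in> bd1 (rev q ! i) \<and> g (s (Suc i)) \<in> bd0 (rev q ! i)))"

text \<open>The identification of \<open>\<pi>\<^sub>1(M)\<close> with \<open>\<pi>\<^sub>1(C, U)\<close>, where \<open>f\<close> is a homeomorphism from \<open>M\<close> to
  the space with base \<open>C\<close> that takes the base point into \<open>U\<close>: the class of \<open>g\<close> corresponds to the
  class of the approximations of \<open>f \<circ> g\<close> by loops at \<open>U\<close>.\<close>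

definition base_identification ::
    "'x set set \<Rightarrow> 'x set \<Rightarrow> ('m \<Rightarrow> 'x) \<Rightarrow> (real \<Rightarrow> 'm) set \<Rightarrow> 'x set simplex1 list set" where
  "base_identification C U f A =
     (\<Union>g\<in>A. \<Union>q\<in>{q \<in> poset_loops (inclusion_order C) U. approximates q (f \<circ> g)}.
        poset_homotopy_class (inclusion_order C) q)"

definition fibre_pi1_map ::
    "'k rel \<Rightarrow> ('k \<Rightarrow> 'k \<Rightarrow> 'x \<Rightarrow> 'x) \<Rightarrow> ('k \<Rightarrow> 'x set set) \<Rightarrow> 'k \<Rightarrow> 'x set \<Rightarrow> ('m \<Rightarrow> 'x) \<Rightarrow>
     (real \<Rightarrow> 'm) set \<Rightarrow> ('k \<times> 'x set) simplex1 list set" where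
  "fibre_pi1_map K J B a U f =
     poset_pi1_map (bundle_order K J B) (\<lambda>V. (a, V)) \<circ> base_identification (B a) U f"

text \<open>The library's \<open>exact_seq\<close> requires all groups of a sequence to have the same element type.\<close>

definition exact_at ::
    "('a, 'c) monoid_scheme \<Rightarrow> ('b, 'd) monoid_scheme \<Rightarrow> ('e, 'f) monoid_scheme \<Rightarrow>
     ('a \<Rightarrow> 'b) \<Rightarrow> ('b \<Rightarrow> 'e) \<Rightarrow> bool" where
  "exact_at G H I f g \<longleftrightarrow> group_hom G H f \<and> group_hom H I g \<and> f ` carrier G = kernel H I g"

end

theory Submission
  imports Defs
begin

text \<open>The maps \<open>J\<close> transport elements of a fibre of \<open>X\<^sub>\<prec>\<close> along the edges of \<open>K\<close>, in both
  directions, and homotopic paths of \<open>K\<close> induce the same transport. Hence a path of \<open>K\<close> has a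
  horizontal lift, homotopic paths have homotopic lifts, and every path of \<open>X\<^sub>\<prec>\<close> is homotopic to a
  path of the initial fibre followed by the lift of its projection. If a loop projects to a
  null-homotopic loop, the lift is trivial, so the loop comes from the fibre; and a lifted loop closes
  up after a path in the connected fibre, which gives surjectivity.

  For the fibre: two poset paths covering the same curve are homotopic by induction on the
  number of edges, cutting both at the latest starting time of their last edges. A path covering a curve
  covers all nearby curves, so the class of the covering paths is constant along a homotopy.
  Conversely, curves covered by the same poset path are homotopic edge by edge, because the
  supports are simply connected.\<close>

section \<open>Homotopy groups of preorders\<close>

text \<open>The maps \<open>J\<close> lead only upwards in \<open>K\<close>, while an edge of
  \<open>K\<close> runs up to its support and down again. The way down exists because
  \<open>J\<close> restricts to isomorphisms of the chosen bases; hence transports are compared in a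
  fibre above, where \<open>J\<close> is injective on base elements. Exchanging a fibre edge with a
  lift changes the element where the lift starts. So a path decomposes with a new starting element
  \<open>U'\<close>, and the point of exactness at the middle group is that \<open>U' = U\<close>
  for a loop with null-homotopic projection. In the fibre the obstacle is that the base need be
  neither directed nor closed under intersections. Two supports containing the same piece of a curve
  may have no common upper bound, and two vertices around the same point may be incomparable. Both
  defects are repaired by small base elements around points of the curve. Exactness is proved for
  the poset group of the fibre; the topological group enters by composition with the isomorphism
  that is part of the final statement.\<close>

abbreviation poset_homotopic :: "'a rel \<Rightarrow> 'a simplex1 list \<Rightarrow> 'a simplex1 list \<Rightarrow> bool" where
  "poset_homotopic P \<equiv> equivclp (elementary_deformation P)"

lemma is_simplex1_Simplex1 [simp]:
  "is_simplex1 P (Simplex1 S y x) \<longleftrightarrow> (y, S) \<in> P \<and> (x, S) \<in> P"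
  by (simp add: is_simplex1_def)

lemma poset_path_from_to_single:
  "poset_path_from_to P x y [b] \<longleftrightarrow> is_simplex1 P b \<and> bd1 b = x \<and> bd0 b = y"
  by (auto simp: poset_path_from_to_def poset_path_def)

lemma poset_path_from_to_append:
  assumes "p \<noteq> []" "q \<noteq> []"
  shows "poset_path_from_to P x z (q @ p) \<longleftrightarrow>
    (\<exists>y. poset_path_from_to P x y p \<and> poset_path_from_to P y z q)"
  using assms by (auto simp: poset_path_from_to_def poset_path_def successively_append_iff)

lemma poset_path_from_to_appendI:
  "poset_path_from_to P x y p \<Longrightarrow> poset_path_from_to P y z q \<Longrightarrow> poset_path_from_to P x z (q @ p)"
  by (auto simp: poset_path_from_to_def poset_path_def successively_append_iff)

lemma poset_path_from_to_Cons:
  "poset_path_from_to P x z (b # p) \<longleftrightarrow> is_simplex1 P b \<and> bd0 b = z \<and>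
    (if p = [] then bd1 b = x else poset_path_from_to P x (bd1 b) p)"
  by (auto simp: poset_path_from_to_def poset_path_def successively_Cons)

lemma poset_path_from_to_nonempty: "poset_path_from_to P x y p \<Longrightarrow> p \<noteq> []"
  by (auto simp: poset_path_from_to_def poset_path_def)

lemma poset_path_imp_from_to:
  "poset_path P p \<Longrightarrow> poset_path_from_to P (bd1 (last p)) (bd0 (hd p)) p"
  by (simp add: poset_path_from_to_def)

text \<open>Lists grow at the head, so the induction extends a path at its end while the starting
  point stays fixed. Transport, lifts and covers are computed in the same direction.\<close>

lemma poset_path_induct [consumes 1, case_names single Cons]:
  assumes "poset_path_from_to P x y p"
    and single: "\<And>b. is_simplex1 P b \<Longrightarrow> bd1 b = x \<Longrightarrow> R (bd0 b) [b]"
    and Cons: "\<And>b p. is_simplex1 P b \<Longrightarrow> poset_path_from_to P x (bd1 b) p \<Longrightarrow> R (bd1 b) p \<Longrightarrow>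
                 R (bd0 b) (b # p)"
  shows "R y p"
  using assms(1)
proof (induction p arbitrary: y)
  case Nil
  then show ?case by (simp add: poset_path_from_to_def poset_path_def)
next
  case (Cons b p)
  then show ?case
    using assms(2)[of b] assms(3)[of b p] by (auto simp: poset_path_from_to_Cons split: if_splits)
qed

lemma elementary_deformationI:
  assumes "is_simplex2 P c" "p = r @ [face1 c] @ s" "q = r @ [face0 c, face2 c] @ s"
    and "poset_path P p" "poset_path P q"
  shows "elementary_deformation P p q"
  using assms unfolding elementary_deformation_def by blast

text \<open>Stated as an equivalence because \<open>equivclp\<close> uses deformations in both
  directions.\<close>

lemma elementary_deformation_from_to:
  assumes "elementary_deformation P p q"
  shows "poset_path_from_to P x y p \<longleftrightarrow> poset_path_from_to P x y q"
proof -
  obtain r s c where c: "is_simplex2 P c" "p = r @ [face1 c] @ s" "q = r @ [face0 c, face2 c] @ s"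
    and "poset_path P p" "poset_path P q"
    using assms by (auto simp: elementary_deformation_def)
  moreover have "bd1 (last p) = bd1 (last q)" "bd0 (hd p) = bd0 (hd q)"
    using c by (auto simp: is_simplex2_def hd_append last_append)
  ultimately show ?thesis by (simp add: poset_path_from_to_def)
qed

lemma poset_homotopic_from_to:
  assumes "poset_homotopic P p q"
  shows "poset_path_from_to P x y p \<longleftrightarrow> poset_path_from_to P x y q"
  using assms by (induction rule: equivclp_induct) (auto dest: elementary_deformation_from_to)

lemma elementary_deformation_context:
  assumes "elementary_deformation P p p'" and "poset_path P (r @ p @ s)"
  shows "elementary_deformation P (r @ p @ s) (r @ p' @ s)"
proof -
  have ends: "p \<noteq> []" "p' \<noteq> []" "poset_path P p" "poset_path P p'"
      "bd1 (last p) = bd1 (last p')" "bd0 (hd p) = bd0 (hd p')"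
    using assms(1) elementary_deformation_from_to[OF assms(1)]
    by (auto simp: elementary_deformation_def poset_path_def poset_path_from_to_def)
  then have "poset_path P (r @ p' @ s)"
    using assms(2) by (auto simp: poset_path_def successively_append_iff)
  moreover obtain u v c where "is_simplex2 P c"
      "p = u @ [face1 c] @ v" "p' = u @ [face0 c, face2 c] @ v"
    using assms(1) by (auto simp: elementary_deformation_def)
  then have "is_simplex2 P c \<and> r @ p @ s = (r @ u) @ [face1 c] @ (v @ s) \<and>
      r @ p' @ s = (r @ u) @ [face0 c, face2 c] @ (v @ s)"
    by simp
  ultimately show ?thesis
    using assms(2) unfolding elementary_deformation_def by blast
qed

text \<open>Deformations relate paths only, but \<open>equivclp\<close> is reflexive on all lists,
  hence the first alternative.\<close>

lemma poset_homotopic_cases: "poset_homotopic P p q \<Longrightarrow> p = q \<or> poset_path P p"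
  by (induction rule: converse_equivclp_induct) (auto simp: elementary_deformation_def)

lemma poset_path_context:
  assumes "poset_homotopic P p p'" and "poset_path P (r @ p @ s)"
  shows "poset_path P (r @ p' @ s)"
proof (cases "p = p'")
  case False
  then have "poset_path P p"
    using assms(1) poset_homotopic_cases by blast
  then have "poset_path_from_to P (bd1 (last p)) (bd0 (hd p)) p'"
    using poset_homotopic_from_to[OF assms(1)] poset_path_imp_from_to by blast
  then show ?thesis
    using assms(2) \<open>poset_path P p\<close>
    by (auto simp: poset_path_def poset_path_from_to_def successively_append_iff)
qed (use assms in auto)

lemma poset_homotopic_context:
  assumes "poset_homotopic P p p'" and "poset_path P (r @ p @ s)"
  shows "poset_homotopic P (r @ p @ s) (r @ p' @ s)"
  using assms(1)
proof (induction rule: equivclp_induct)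
  case (step y z)
  have "poset_path P (r @ y @ s)" "poset_path P (r @ z @ s)"
    using poset_path_context assms(2) step.hyps equivclp_into_equivclp by metis+
  then have "elementary_deformation P (r @ y @ s) (r @ z @ s) \<or>
      elementary_deformation P (r @ z @ s) (r @ y @ s)"
    using step.hyps elementary_deformation_context by metis
  then show ?case using step.IH equivclp_into_equivclp by metis
qed simp

lemma poset_homotopic_append:
  assumes "poset_homotopic P p p'" "poset_homotopic P q q'"
    and "poset_path_from_to P x y p" "poset_path_from_to P y z q"
  shows "poset_homotopic P (q @ p) (q' @ p')"
proof -
  have "poset_path P (q @ p)"
    using assms(3,4) poset_path_from_to_appendI by (metis poset_path_from_to_def)
  then have 1: "poset_homotopic P (q @ p) (q @ p')"
    using poset_homotopic_context[OF assms(1), of q "[]"] by simp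
  have "poset_path P (q @ p')"
    using poset_path_context[OF assms(1), of q "[]"] \<open>poset_path P (q @ p)\<close> by simp
  then have "poset_homotopic P (q @ p') (q' @ p')"
    using poset_homotopic_context[OF assms(2), of "[]" p'] by simp
  with 1 show ?thesis by (rule equivclp_trans)
qed

section \<open>Reversal and contraction of paths\<close>

definition reverse_simplex1 :: "'a simplex1 \<Rightarrow> 'a simplex1" where
  "reverse_simplex1 b = Simplex1 (supp b) (bd1 b) (bd0 b)"

definition reverse_path :: "'a simplex1 list \<Rightarrow> 'a simplex1 list" where
  "reverse_path p = rev (map reverse_simplex1 p)"

lemma reverse_simplex1_simps [simp]:
  "supp (reverse_simplex1 b) = supp b" "bd0 (reverse_simplex1 b) = bd1 b"
  "bd1 (reverse_simplex1 b) = bd0 b" "is_simplex1 P (reverse_simplex1 b) = is_simplex1 P b"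
  by (auto simp: reverse_simplex1_def is_simplex1_def)

lemma reverse_path_Cons [simp]: "reverse_path (b # p) = reverse_path p @ [reverse_simplex1 b]"
  by (simp add: reverse_path_def)

lemma reverse_path_from_to:
  "poset_path_from_to P x y p \<Longrightarrow> poset_path_from_to P y x (reverse_path p)"
proof (induction rule: poset_path_induct)
  case (single b)
  then show ?case by (simp add: poset_path_from_to_single reverse_path_def)
next
  case (Cons b p)
  then show ?case
    by (auto intro!: poset_path_from_to_appendI simp: poset_path_from_to_single)
qed

text \<open>Reflexivity is required at the elements occurring in the relation, so the relation
  determines its own carrier. \<open>K\<close>, the inclusion orders and \<open>X_order\<close> are
  instances.\<close>

locale preordering =
  fixes P :: "'a rel"
  assumes refl_left: "(x, y) \<in> P \<Longrightarrow> (x, x) \<in> P"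
    and refl_right: "(x, y) \<in> P \<Longrightarrow> (y, y) \<in> P"
    and trans: "(x, y) \<in> P \<Longrightarrow> (y, z) \<in> P \<Longrightarrow> (x, z) \<in> P"
begin

lemma simplex1_refl:
  assumes "is_simplex1 P b"
  shows "(supp b, supp b) \<in> P" "(bd0 b, bd0 b) \<in> P" "(bd1 b, bd1 b) \<in> P"
  using assms refl_left refl_right unfolding is_simplex1_def by blast+

lemma path_ends_refl:
  "poset_path_from_to P x y p \<Longrightarrow> (x, x) \<in> P \<and> (y, y) \<in> P"
  by (induction rule: poset_path_induct) (auto simp: simplex1_refl)

text \<open>The vertices are \<open>x\<close>, \<open>y\<close>, \<open>z\<close> in the order of
  traversal; face \<open>i\<close> of the 2-simplex leaves out vertex number \<open>i\<close>,
  counted from 0.\<close>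

lemma triangle:
  assumes "(z, S1) \<in> P" "(x, S1) \<in> P" "(z, S0) \<in> P" "(y, S0) \<in> P" "(y, S2) \<in> P" "(x, S2) \<in> P"
    and "(S0, S) \<in> P" "(S1, S) \<in> P" "(S2, S) \<in> P"
  shows "poset_homotopic P [Simplex1 S1 z x] [Simplex1 S0 z y, Simplex1 S2 y x]"
proof -
  let ?c = "Simplex2 S (Simplex1 S0 z y) (Simplex1 S1 z x) (Simplex1 S2 y x)"
  have "is_simplex2 P ?c \<and> [Simplex1 S1 z x] = [] @ [face1 ?c] @ [] \<and>
     [Simplex1 S0 z y, Simplex1 S2 y x] = [] @ [face0 ?c, face2 ?c] @ []"
    using assms by (simp add: is_simplex2_def is_simplex1_def)
  moreover have "poset_path P [Simplex1 S1 z x]" "poset_path P [Simplex1 S0 z y, Simplex1 S2 y x]"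
    using assms by (auto simp: poset_path_def is_simplex1_def)
  ultimately show ?thesis unfolding elementary_deformation_def by blast
qed

text \<open>Both edges are homotopic to the product of the smaller one with a degenerate edge.\<close>
lemma enlarge_support:
  assumes "(y, S) \<in> P" "(x, S) \<in> P" "(S, S') \<in> P"
  shows "poset_homotopic P [Simplex1 S y x] [Simplex1 S' y x]"
proof -
  have "poset_homotopic P [Simplex1 S'' y x] [Simplex1 y y y, Simplex1 S y x]"
    if "(S, S'') \<in> P" for S''
    by (rule triangle[where S = S'']) (use assms that trans refl_left refl_right in blast)+
  then show ?thesis
    using assms refl_left refl_right by (meson equivclp_sym equivclp_trans)
qed

text \<open>A poset with a greatest element is simply connected: with \<open>S\<close> above
  everything, each further edge is absorbed by one triangle with support \<open>S\<close>.\<close>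

lemma contract_path:
  assumes "poset_path_from_to P x y p" and "\<And>b. b \<in> set p \<Longrightarrow> (supp b, S) \<in> P"
  shows "poset_homotopic P p [Simplex1 S y x]"
  using assms
proof (induction rule: poset_path_induct)
  case (single b)
  then show ?case
    using enlarge_support[of "bd0 b" "supp b" "bd1 b" S] by (auto simp: is_simplex1_def)
next
  case (Cons b p)
  have b: "(bd0 b, supp b) \<in> P" "(bd1 b, supp b) \<in> P" "(supp b, S) \<in> P"
    using Cons by (auto simp: is_simplex1_def)
  \<comment> \<open>The start \<open>x\<close> is an end of the edge traversed first, which is the
    last one in the list.\<close>
  have "\<exists>b' \<in> set p. bd1 b' = x \<and> is_simplex1 P b' \<and> (supp b', S) \<in> P"
    using Cons.hyps Cons.prems
    by (auto simp: poset_path_from_to_def poset_path_def intro!: bexI[of _ "last p"])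
  then have "(x, S) \<in> P" using trans by (auto simp: is_simplex1_def)
  have "poset_homotopic P ([b] @ p) ([b] @ [Simplex1 S (bd1 b) x])"
  proof (rule poset_homotopic_append)
    show "poset_path_from_to P (bd1 b) (bd0 b) [b]"
      using Cons by (simp add: poset_path_from_to_single)
  qed (use Cons in auto)
  also have "poset_homotopic P ([b] @ [Simplex1 S (bd1 b) x]) [Simplex1 S (bd0 b) x]"
    using triangle[of "bd0 b" S x "supp b" "bd1 b" S S] b \<open>(x, S) \<in> P\<close> trans refl_right
    by (metis append_Cons append_Nil equivclp_sym simplex1.collapse)
  finally show ?case by simp
qed

text \<open>The working form of contraction: naming one element above all supports replaces the
  choice of triangles.\<close>

lemma homotopic_if_common_bound:
  assumes "poset_path_from_to P x y p" "poset_path_from_to P x y q"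
    and "\<And>b. b \<in> set p \<union> set q \<Longrightarrow> (supp b, S) \<in> P"
  shows "poset_homotopic P p q"
  using contract_path[of x y p S] contract_path[of x y q S] assms
  by (metis UnI1 UnI2 equivclp_sym equivclp_trans)

text \<open>The degenerate edge is absorbed by the final edge of \<open>p\<close>, below the support
  of that edge.\<close>

lemma id_left:
  assumes "poset_path_from_to P x y p"
  shows "poset_homotopic P (Simplex1 y y y # p) p"
  using assms
proof (induction rule: poset_path_induct)
  case (single b)
  have "poset_homotopic P [Simplex1 (bd0 b) (bd0 b) (bd0 b), b] [b]"
    by (rule homotopic_if_common_bound[where x = x and y = "bd0 b" and S = "supp b"])
      (use single in \<open>auto simp: poset_path_from_to_Cons simplex1_refl is_simplex1_def[of P "b"]\<close>)
  then show ?case by simp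
next
  case (Cons b p)
  have "poset_homotopic P [Simplex1 (bd0 b) (bd0 b) (bd0 b), b] [b]"
    by (rule homotopic_if_common_bound[where x = "bd1 b" and y = "bd0 b" and S = "supp b"])
      (use Cons in \<open>auto simp: poset_path_from_to_Cons simplex1_refl is_simplex1_def[of P "b"]\<close>)
  then have "poset_homotopic P ([Simplex1 (bd0 b) (bd0 b) (bd0 b), b] @ p) ([b] @ p)"
    by (rule poset_homotopic_append[OF equivclp_refl _ Cons(2), where z = "bd0 b"])
      (use Cons in \<open>auto simp: poset_path_from_to_Cons simplex1_refl is_simplex1_def[of P "b"]\<close>)
  then show ?case by simp
qed

text \<open>Cancellation starts in the middle, where the final edge of \<open>p\<close> meets its
  reverse.\<close>

lemma reverse_path_left:
  assumes "poset_path_from_to P x y p"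
  shows "poset_homotopic P (reverse_path p @ p) [Simplex1 x x x]"
  using assms
proof (induction rule: poset_path_induct)
  case (single b)
  then show ?case
    by (intro homotopic_if_common_bound[where x = x and y = x and S = "supp b"])
     (auto simp: poset_path_from_to_Cons simplex1_refl is_simplex1_def[of P "b"] reverse_path_def)
next
  case (Cons b p)
  let ?y = "bd1 b"
  have "poset_homotopic P [reverse_simplex1 b, b] [Simplex1 ?y ?y ?y]"
    by (rule homotopic_if_common_bound[where x = ?y and y = ?y and S = "supp b"])
      (use Cons in \<open>auto simp: poset_path_from_to_Cons simplex1_refl is_simplex1_def[of P "b"]\<close>)
  moreover have "poset_path_from_to P ?y ?y [reverse_simplex1 b, b]"
    using Cons by (auto simp: poset_path_from_to_Cons)
  ultimately have "poset_homotopic P ([reverse_simplex1 b, b] @ p) ([Simplex1 ?y ?y ?y] @ p)"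
    and ft: "poset_path_from_to P x ?y ([reverse_simplex1 b, b] @ p)"
    using Cons.hyps(2) poset_homotopic_append[OF equivclp_refl] poset_path_from_to_appendI
    by metis+
  then have "poset_homotopic P ([reverse_simplex1 b, b] @ p) p"
    using id_left[OF Cons.hyps(2)] equivclp_trans by fastforce
  then have "poset_homotopic P (reverse_path p @ [reverse_simplex1 b, b] @ p) (reverse_path p @ p)"
    using poset_homotopic_append[OF _ equivclp_refl ft reverse_path_from_to[OF Cons.hyps(2)]] by simp
  with Cons.IH show ?case by (metis append.assoc append_Cons append_Nil equivclp_trans reverse_path_Cons)
qed

end

section \<open>Group structure on the classes of loops\<close>

lemma poset_homotopy_class_eq:
  "poset_homotopy_class P p = poset_homotopy_class P q \<longleftrightarrow> poset_homotopic P p q"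
  by (auto simp: poset_homotopy_class_def intro: equivclp_trans equivclp_sym)

lemma mem_poset_homotopy_class: "q \<in> poset_homotopy_class P p \<longleftrightarrow> poset_homotopic P p q"
  by (simp add: poset_homotopy_class_def)

lemma poset_pi1_mult:
  assumes "p \<in> poset_loops P a" "q \<in> poset_loops P a"
  shows "poset_homotopy_class P q \<otimes>\<^bsub>poset_pi1 P a\<^esub> poset_homotopy_class P p =
    poset_homotopy_class P (q @ p)"
proof -
  have "poset_homotopy_class P (q' @ p') = poset_homotopy_class P (q @ p)"
    if "q' \<in> poset_homotopy_class P q" "p' \<in> poset_homotopy_class P p" for q' p'
    using that assms poset_homotopic_append[of P p p' q q' a a a] equivclp_sym
    unfolding poset_homotopy_class_eq mem_poset_homotopy_class poset_loops_def by auto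
  moreover have "q \<in> poset_homotopy_class P q" "p \<in> poset_homotopy_class P p"
    by (auto simp: mem_poset_homotopy_class)
  ultimately show ?thesis unfolding poset_pi1_def monoid.simps by blast
qed

lemma carrier_poset_pi1: "carrier (poset_pi1 P a) = poset_homotopy_class P ` poset_loops P a"
  by (simp add: poset_pi1_def)

lemma one_poset_pi1: "\<one>\<^bsub>poset_pi1 P a\<^esub> = poset_homotopy_class P [Simplex1 a a a]"
  by (simp add: poset_pi1_def)

lemma append_poset_loops:
  "p \<in> poset_loops P a \<Longrightarrow> q \<in> poset_loops P a \<Longrightarrow> q @ p \<in> poset_loops P a"
  by (auto simp: poset_loops_def intro: poset_path_from_to_appendI)

lemma (in preordering) group_poset_pi1:
  assumes "(a, a) \<in> P"
  shows "group (poset_pi1 P a)"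
proof (rule groupI)
  show "x \<otimes>\<^bsub>poset_pi1 P a\<^esub> y \<in> carrier (poset_pi1 P a)"
    if "x \<in> carrier (poset_pi1 P a)" "y \<in> carrier (poset_pi1 P a)" for x y
    using that by (auto simp: carrier_poset_pi1 poset_pi1_mult append_poset_loops)
  have 1: "[Simplex1 a a a] \<in> poset_loops P a"
    using assms by (simp add: poset_loops_def poset_path_from_to_single)
  then show "\<one>\<^bsub>poset_pi1 P a\<^esub> \<in> carrier (poset_pi1 P a)"
    by (simp add: carrier_poset_pi1 one_poset_pi1)
  show "x \<otimes>\<^bsub>poset_pi1 P a\<^esub> y \<otimes>\<^bsub>poset_pi1 P a\<^esub> z = x \<otimes>\<^bsub>poset_pi1 P a\<^esub> (y \<otimes>\<^bsub>poset_pi1 P a\<^esub> z)"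
    if "x \<in> carrier (poset_pi1 P a)" "y \<in> carrier (poset_pi1 P a)" "z \<in> carrier (poset_pi1 P a)"
    for x y z
    using that by (auto simp: carrier_poset_pi1 poset_pi1_mult append_poset_loops)
  show "\<one>\<^bsub>poset_pi1 P a\<^esub> \<otimes>\<^bsub>poset_pi1 P a\<^esub> x = x" if x: "x \<in> carrier (poset_pi1 P a)" for x
  proof -
    obtain p where p: "x = poset_homotopy_class P p" "p \<in> poset_loops P a"
      using x by (auto simp: carrier_poset_pi1)
    then have "poset_homotopic P (Simplex1 a a a # p) p"
      by (auto simp: poset_loops_def intro: id_left)
    then show ?thesis
      by (simp add: p poset_pi1_mult[OF p(2) 1] one_poset_pi1 poset_homotopy_class_eq)
  qed
  show "\<exists>y\<in>carrier (poset_pi1 P a). y \<otimes>\<^bsub>poset_pi1 P a\<^esub> x = \<one>\<^bsub>poset_pi1 P a\<^esub>"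
    if x: "x \<in> carrier (poset_pi1 P a)" for x
  proof -
    obtain p where p: "x = poset_homotopy_class P p" "p \<in> poset_loops P a"
      using x by (auto simp: carrier_poset_pi1)
    then have "reverse_path p \<in> poset_loops P a"
        "poset_homotopic P (reverse_path p @ p) [Simplex1 a a a]"
      by (auto simp: poset_loops_def intro: reverse_path_from_to reverse_path_left)
    then show ?thesis
      using p by (auto simp: poset_pi1_mult one_poset_pi1 poset_homotopy_class_eq carrier_poset_pi1)
  qed
qed

section \<open>Induced homomorphisms\<close>

definition order_map :: "'a rel \<Rightarrow> 'b rel \<Rightarrow> ('a \<Rightarrow> 'b) \<Rightarrow> bool" where
  "order_map P Q f \<longleftrightarrow> (\<forall>(x, y) \<in> P. (f x, f y) \<in> Q)"

lemma map_simplex1_sel [simp]: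
  "supp (map_simplex1 f b) = f (supp b)" "bd0 (map_simplex1 f b) = f (bd0 b)"
  "bd1 (map_simplex1 f b) = f (bd1 b)"
  by (cases b; simp)+

lemma map_path_from_to:
  assumes "order_map P Q f" "poset_path_from_to P x y p"
  shows "poset_path_from_to Q (f x) (f y) (map (map_simplex1 f) p)"
  using assms(2)
proof (induction rule: poset_path_induct)
  case (single b)
  then show ?case using assms(1)
    by (auto simp: poset_path_from_to_Cons is_simplex1_def order_map_def
        dest: poset_path_from_to_nonempty)
next
  case (Cons b p)
  then show ?case using assms(1)
    by (auto simp: poset_path_from_to_Cons is_simplex1_def order_map_def
        dest: poset_path_from_to_nonempty)
qed

lemma map_poset_homotopic:
  assumes f: "order_map P Q f" and "poset_homotopic P p q"
  shows "poset_homotopic Q (map (map_simplex1 f) p) (map (map_simplex1 f) q)"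
proof -
  have *: "elementary_deformation Q (map (map_simplex1 f) p) (map (map_simplex1 f) q)"
    if pq: "elementary_deformation P p q" for p q
  proof -
    obtain r s c where c: "is_simplex2 P c" "p = r @ [face1 c] @ s" "q = r @ [face0 c, face2 c] @ s"
      and "poset_path P p" "poset_path P q"
      using pq by (auto simp: elementary_deformation_def)
    let ?F = "map_simplex1 f"
    let ?c = "Simplex2 (f (supp2 c)) (?F (face0 c)) (?F (face1 c)) (?F (face2 c))"
    have "is_simplex2 Q ?c \<and> map ?F p = map ?F r @ [face1 ?c] @ map ?F s \<and>
        map ?F q = map ?F r @ [face0 ?c, face2 ?c] @ map ?F s"
      using c f by (auto simp: is_simplex2_def is_simplex1_def order_map_def)
    moreover have "poset_path Q (map ?F p)" "poset_path Q (map ?F q)"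
      using map_path_from_to[OF f poset_path_imp_from_to] \<open>poset_path P p\<close> \<open>poset_path P q\<close>
      unfolding poset_path_from_to_def by blast+
    ultimately show ?thesis unfolding elementary_deformation_def by blast
  qed
  show ?thesis
    using assms(2)
  proof (induction rule: equivclp_induct)
    case (step y z)
    show ?case
      using equivclp_into_equivclp[OF step.IH] *[of y z] *[of z y] step.hyps(2) by blast
  qed simp
qed

lemma poset_pi1_map_class:
  assumes "order_map P Q f"
  shows "poset_pi1_map Q f (poset_homotopy_class P p) = poset_homotopy_class Q (map (map_simplex1 f) p)"
proof -
  have "poset_homotopy_class Q (map (map_simplex1 f) q) = poset_homotopy_class Q (map (map_simplex1 f) p)"
    if "q \<in> poset_homotopy_class P p" for q
    using map_poset_homotopic[OF assms, of p q] that
    by (simp add: poset_homotopy_class_eq mem_poset_homotopy_class equivclp_sym)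
  moreover have "p \<in> poset_homotopy_class P p" by (simp add: mem_poset_homotopy_class)
  ultimately show ?thesis unfolding poset_pi1_map_def by blast
qed

lemma poset_pi1_map_hom:
  assumes "order_map P Q f"
  shows "poset_pi1_map Q f \<in> hom (poset_pi1 P a) (poset_pi1 Q (f a))"
proof -
  have "map (map_simplex1 f) p \<in> poset_loops Q (f a)" if "p \<in> poset_loops P a" for p
    using map_path_from_to[OF assms] that by (simp add: poset_loops_def)
  then show ?thesis
    by (auto simp: hom_def carrier_poset_pi1 poset_pi1_mult poset_pi1_map_class[OF assms]
        append_poset_loops)
qed

section \<open>Lifting paths to the poset net bundle\<close>

lemma preordering_partial_order:
  assumes "Partial_order K"
  shows "preordering K"
proof -
  have "\<forall>x \<in> Field K. (x, x) \<in> K" "trans K"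
    using assms by (auto simp: partial_order_on_def preorder_on_def refl_on_def)
  then show ?thesis
    by unfold_locales (auto intro: FieldI1 FieldI2 dest: transD)
qed

lemma preordering_inclusion_order: "preordering (inclusion_order C)"
  by unfold_locales (auto simp: inclusion_order_def)

lemma mem_inclusion_order: "(U, V) \<in> inclusion_order C \<longleftrightarrow> U \<in> C \<and> V \<in> C \<and> U \<subseteq> V"
  by (simp add: inclusion_order_def)

lemma mem_bundle_order:
  "((a, U), (b, V)) \<in> bundle_order K J B \<longleftrightarrow> U \<in> B a \<and> V \<in> B b \<and> (a, b) \<in> K \<and> J b a ` U \<subseteq> V"
  by (simp add: bundle_order_def)

lemma inclusion_path_ends:
  "poset_path_from_to (inclusion_order C) U V F \<Longrightarrow> U \<in> C \<and> V \<in> C"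
  using preordering.path_ends_refl[OF preordering_inclusion_order] by (fastforce simp: mem_inclusion_order)

section \<open>Transport along edges and horizontal lifts\<close>

context poset_net_bundle
begin

abbreviation X_order :: "('k \<times> 'x set) rel" where
  "X_order \<equiv> bundle_order K J B"

sublocale base: preordering K
  using poset by (rule preordering_partial_order)

lemma Field_refl: "a \<in> Field K \<Longrightarrow> (a, a) \<in> K"
  using base.refl_left base.refl_right by (auto simp: Field_def)

lemma J_image_mem: "(a, b) \<in> K \<Longrightarrow> U \<in> B a \<Longrightarrow> J b a ` U \<in> B b"
  using B_bij[of a b] by (auto simp: bij_betw_def)

lemma B_subset_topspace: "a \<in> Field K \<Longrightarrow> U \<in> B a \<Longrightarrow> U \<subseteq> topspace (T a)"
  using B_open openin_subset by blast

lemma J_image_refl: "a \<in> Field K \<Longrightarrow> U \<in> B a \<Longrightarrow> J a a ` U = U"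
  using B_subset_topspace[of a U] J_refl[of a] by (auto simp: image_iff subset_iff)

lemma J_image_comp:
  assumes "(a, b) \<in> K" "(b, c) \<in> K" "U \<in> B a"
  shows "J c b ` J b a ` U = J c a ` U"
proof -
  have "U \<subseteq> topspace (T a)" using assms B_subset_topspace by (auto intro: FieldI1)
  then show ?thesis
    using J_comp[OF assms(1,2)] by (auto simp: image_image subset_iff intro!: image_cong)
qed

lemma J_image_inj:
  "(a, b) \<in> K \<Longrightarrow> U \<in> B a \<Longrightarrow> V \<in> B a \<Longrightarrow> J b a ` U = J b a ` V \<Longrightarrow> U = V"
  using B_bij[of a b] by (auto simp: bij_betw_def inj_on_def)

sublocale total: preordering X_order
proof
  fix x y z
  have refl: "((a, U), (a, U)) \<in> X_order" if "a \<in> Field K" "U \<in> B a" for a U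
    using that by (simp add: mem_bundle_order J_image_refl Field_refl)
  show "(x, x) \<in> X_order" if "(x, y) \<in> X_order"
    using that refl[of "fst x" "snd x"] unfolding bundle_order_def by (force dest: FieldI1)
  show "(y, y) \<in> X_order" if "(x, y) \<in> X_order"
    using that refl[of "fst y" "snd y"] unfolding bundle_order_def by (force dest: FieldI2)
  show "(x, z) \<in> X_order" if "(x, y) \<in> X_order" "(y, z) \<in> X_order"
  proof -
    obtain a U b V c W where eq: "x = (a, U)" "y = (b, V)" "z = (c, W)"
      by (cases x, cases y, cases z)
    have *: "U \<in> B a" "W \<in> B c" "(a, b) \<in> K" "(b, c) \<in> K" "J b a ` U \<subseteq> V" "J c b ` V \<subseteq> W"
      using that by (auto simp: eq mem_bundle_order)
    then have "J c a ` U \<subseteq> W" using J_image_comp[of a b c U] by blast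
    with * base.trans show ?thesis by (auto simp: eq mem_bundle_order)
  qed
qed

text \<open>The inverse of the isomorphism from \<open>B d\<close> to \<open>B e\<close> given by
  \<open>B_bij\<close>. Inverting on the bases, not on points, keeps the result in
  \<open>B d\<close>.\<close>

definition pullback :: "'k \<Rightarrow> 'k \<Rightarrow> 'x set \<Rightarrow> 'x set" where
  "pullback e d = inv_into (B d) ((`) (J e d))"

lemma pullback:
  assumes "(d, e) \<in> K" "V \<in> B e"
  shows "pullback e d V \<in> B d" "J e d ` pullback e d V = V"
  using B_bij[OF assms(1)] assms(2) unfolding pullback_def bij_betw_def
  by (metis inv_into_into, metis f_inv_into_f)

text \<open>Holonomy of an edge: up to the support with \<open>J\<close>, down to the end with
  \<open>pullback\<close>.\<close>

definition transport :: "'k simplex1 \<Rightarrow> 'x set \<Rightarrow> 'x set" where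
  "transport b V = pullback (supp b) (bd0 b) (J (supp b) (bd1 b) ` V)"

lemma transport_mem: "is_simplex1 K b \<Longrightarrow> V \<in> B (bd1 b) \<Longrightarrow> transport b V \<in> B (bd0 b)"
  by (auto simp: transport_def is_simplex1_def intro!: pullback J_image_mem)

text \<open>The element \<open>e\<close> is free so that the edges of a 2-simplex, whose supports
  may differ, can be compared in the one fibre over \<open>supp2 c\<close>.\<close>

lemma J_transport:
  assumes "is_simplex1 K b" "V \<in> B (bd1 b)" "(supp b, e) \<in> K"
  shows "J e (bd0 b) ` transport b V = J e (bd1 b) ` V"
proof -
  have b: "(bd0 b, supp b) \<in> K" "(bd1 b, supp b) \<in> K"
    using assms(1) by (auto simp: is_simplex1_def)
  have "J e (supp b) ` J (supp b) (bd0 b) ` transport b V = J e (supp b) ` J (supp b) (bd1 b) ` V"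
    using b assms(2) by (simp add: transport_def pullback J_image_mem)
  then show ?thesis
    using b assms transport_mem by (simp add: J_image_comp)
qed

lemma J_transport_supp:
  assumes "is_simplex1 K b" "V \<in> B (bd1 b)"
  shows "J (supp b) (bd0 b) ` transport b V = J (supp b) (bd1 b) ` V"
  using J_transport[OF assms base.simplex1_refl(1)[OF assms(1)]] .

text \<open>\<open>J e (bd0 b)\<close> is injective on \<open>B (bd0 b)\<close>, so the equation of
  \<open>J_transport\<close> determines the transport.\<close>

lemma transport_eqI:
  assumes "is_simplex1 K b" "V \<in> B (bd1 b)" "W \<in> B (bd0 b)"
    and "(supp b, e) \<in> K" "J e (bd0 b) ` W = J e (bd1 b) ` V"
  shows "transport b V = W"
proof (rule J_image_inj[of "bd0 b" e])
  show "(bd0 b, e) \<in> K" using assms base.trans by (auto simp: is_simplex1_def)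
qed (use assms transport_mem J_transport in auto)

text \<open>Horizontal: the second component of the support is the image of both ends, of the start
  by definition and of the end by \<open>J_transport_supp\<close>.\<close>

abbreviation lift_simplex1 :: "'k simplex1 \<Rightarrow> 'x set \<Rightarrow> ('k \<times> 'x set) simplex1" where
  "lift_simplex1 b V \<equiv>
    Simplex1 (supp b, J (supp b) (bd1 b) ` V) (bd0 b, transport b V) (bd1 b, V)"

text \<open>The head edge is traversed last, so it starts where transport along the tail has
  led.\<close>

primrec lift :: "'k simplex1 list \<Rightarrow> 'x set \<Rightarrow> ('k \<times> 'x set) simplex1 list" where
  "lift [] V = []"
| "lift (b # w) V = lift_simplex1 b (foldr transport w V) # lift w V"

lemma lift_append: "lift (v @ w) V = lift v (foldr transport w V) @ lift w V"
  by (induction v) auto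

lemma transport_path_mem:
  assumes "poset_path_from_to K x y w" "V \<in> B x"
  shows "foldr transport w V \<in> B y"
  using assms
  by (induction rule: poset_path_induct) (auto intro: transport_mem)

lemma is_simplex1_lift:
  assumes "is_simplex1 K b" "V \<in> B (bd1 b)"
  shows "is_simplex1 X_order (lift_simplex1 b V)"
  using assms transport_mem[OF assms] J_transport_supp[OF assms] J_image_mem
  by (auto simp: mem_bundle_order is_simplex1_def[of K])

lemma lift_from_to:
  assumes "poset_path_from_to K x y w" "V \<in> B x"
  shows "poset_path_from_to X_order (x, V) (y, foldr transport w V) (lift w V)"
  using assms
proof (induction rule: poset_path_induct)
  case (single b)
  then show ?case
    using is_simplex1_lift[of b V] by (auto simp: poset_path_from_to_single)
next
  case (Cons b w)
  then show ?case
    using is_simplex1_lift[of b "foldr transport w V"] transport_path_mem[OF Cons.hyps(2), of V]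
    by (auto simp: poset_path_from_to_Cons dest: poset_path_from_to_nonempty)
qed

text \<open>The lifted 2-simplex lies over \<open>supp2 c\<close>, with the image of
  \<open>V'\<close> in that fibre as the second component of its support; the supports of all three
  lifted edges are mapped onto it.\<close>

lemma lift_elementary_deformation:
  assumes "elementary_deformation K v w" "poset_path_from_to K x y v" "V \<in> B x"
  shows "elementary_deformation X_order (lift v V) (lift w V)"
    and "foldr transport v V = foldr transport w V"
proof -
  obtain r s c where c: "is_simplex2 K c" "v = r @ [face1 c] @ s" "w = r @ [face0 c, face2 c] @ s"
    using assms(1) by (auto simp: elementary_deformation_def)
  define V' where "V' = foldr transport s V"
  define W where "W = transport (face2 c) V'"
  have c': "is_simplex1 K (face0 c)" "is_simplex1 K (face1 c)" "is_simplex1 K (face2 c)"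
      "(supp (face0 c), supp2 c) \<in> K" "(supp (face1 c), supp2 c) \<in> K" "(supp (face2 c), supp2 c) \<in> K"
      "bd0 (face1 c) = bd0 (face0 c)" "bd0 (face2 c) = bd1 (face0 c)" "bd1 (face2 c) = bd1 (face1 c)"
    using c(1) by (auto simp: is_simplex2_def)
  have V': "V' \<in> B (bd1 (face1 c))"
  proof (cases "s = []")
    case True
    then show ?thesis using assms(2,3) by (auto simp: c V'_def poset_path_from_to_def)
  next
    case False
    then have "poset_path_from_to K x (bd1 (face1 c)) s"
      using assms(2) unfolding c
      by (cases "r = []") (auto simp: poset_path_from_to_append poset_path_from_to_Cons)
    then show ?thesis unfolding V'_def using assms(3) by (rule transport_path_mem)
  qed
  have W: "W \<in> B (bd1 (face0 c))" "J (supp2 c) (bd1 (face0 c)) ` W = J (supp2 c) (bd1 (face1 c)) ` V'"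
    using transport_mem[of "face2 c" V'] J_transport[of "face2 c" V' "supp2 c"] c' V'
    by (auto simp: W_def)
  \<comment> \<open>Transport along \<open>face1 c\<close>, and along \<open>face2 c\<close> and
    then \<open>face0 c\<close>, have the same image over \<open>supp2 c\<close>.\<close>
  have eq: "transport (face1 c) V' = transport (face0 c) W"
    using transport_eqI[of "face1 c" V' "transport (face0 c) W" "supp2 c"] c' V' W
      transport_mem[of "face0 c" W] J_transport[of "face0 c" W "supp2 c"] by simp
  then show tr: "foldr transport v V = foldr transport w V"
    by (simp add: c V'_def W_def)
  let ?c = "Simplex2 (supp2 c, J (supp2 c) (bd1 (face1 c)) ` V')
    (lift_simplex1 (face0 c) W) (lift_simplex1 (face1 c) V') (lift_simplex1 (face2 c) V')"
  have le: "((supp b, J (supp b) (bd1 b) ` U), (supp2 c, J (supp2 c) (bd1 b) ` U)) \<in> X_order"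
    if "is_simplex1 K b" "(supp b, supp2 c) \<in> K" "U \<in> B (bd1 b)" for b U
    using that J_image_comp[of "bd1 b" "supp b" "supp2 c" U] base.trans
    by (auto simp: mem_bundle_order is_simplex1_def intro!: J_image_mem)
  have "is_simplex2 X_order ?c"
    using c' V' W eq is_simplex1_lift[of "face0 c" W] is_simplex1_lift[of "face1 c" V']
      is_simplex1_lift[of "face2 c" V'] le[of "face0 c" W] le[of "face1 c" V'] le[of "face2 c" V']
    by (simp add: is_simplex2_def W_def del: is_simplex1_Simplex1)
  moreover have "lift v V = lift r (transport (face1 c) V') @ [face1 ?c] @ lift s V"
      "lift w V = lift r (transport (face1 c) V') @ [face0 ?c, face2 ?c] @ lift s V"
    by (simp_all add: c lift_append V'_def W_def eq[unfolded V'_def W_def])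
  moreover have "poset_path X_order (lift v V)" "poset_path X_order (lift w V)"
    using lift_from_to[OF _ assms(3), of y] assms(2)
      elementary_deformation_from_to[OF assms(1), of x y]
    unfolding poset_path_from_to_def[of X_order] by blast+
  ultimately show "elementary_deformation X_order (lift v V) (lift w V)"
    by (rule elementary_deformationI)
qed

text \<open>Homotopy lifting. The second claim says that holonomy depends on the homotopy class
  only, so the lifts of homotopic paths end at the same element.\<close>

lemma lift_homotopic:
  assumes "poset_homotopic K v w" "poset_path_from_to K x y v" "V \<in> B x"
  shows "poset_homotopic X_order (lift v V) (lift w V)"
    and "foldr transport v V = foldr transport w V"
proof -
  have "poset_homotopic X_order (lift v V) (lift w V) \<and> foldr transport v V = foldr transport w V"
    using assms(1)
  proof (induction rule: equivclp_induct)
    case (step y' z)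
    have "poset_path_from_to K x y y'" "poset_path_from_to K x y z"
      using poset_homotopic_from_to[OF step.hyps(1), of x y] assms(2) step.hyps(2)
        elementary_deformation_from_to[of K y' z x y] elementary_deformation_from_to[of K z y' x y]
      by blast+
    have *: "(elementary_deformation X_order (lift y' V) (lift z V) \<or>
        elementary_deformation X_order (lift z V) (lift y' V)) \<and>
        foldr transport y' V = foldr transport z V"
      using step.hyps(2)
    proof
      assume "elementary_deformation K y' z"
      from lift_elementary_deformation[OF this _ assms(3), of y] show ?thesis
        using \<open>poset_path_from_to K x y y'\<close> by simp
    next
      assume "elementary_deformation K z y'"
      from lift_elementary_deformation[OF this _ assms(3), of y] show ?thesis
        using \<open>poset_path_from_to K x y z\<close> by simp
    qed
    then have "poset_homotopic X_order (lift v V) (lift z V)"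
      using step.IH equivclp_into_equivclp by metis
    with * step.IH show ?case by simp
  qed simp
  then show "poset_homotopic X_order (lift v V) (lift w V)"
    and "foldr transport v V = foldr transport w V" by auto
qed

section \<open>Exchange of fibre paths and horizontal lifts\<close>

abbreviation fibre_path :: "'k \<Rightarrow> 'x set simplex1 list \<Rightarrow> ('k \<times> 'x set) simplex1 list" where
  "fibre_path a \<equiv> map (map_simplex1 (Pair a))"

lemma order_map_fibre:
  assumes "a \<in> Field K"
  shows "order_map (inclusion_order (B a)) X_order (Pair a)"
proof -
  have "((a, U), (a, V)) \<in> X_order" if "(U, V) \<in> inclusion_order (B a)" for U V
    using that assms
    by (simp add: mem_inclusion_order mem_bundle_order J_image_refl Field_refl)
  then show ?thesis by (auto simp: order_map_def)
qed

lemma order_map_fst: "order_map X_order K fst"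
  by (auto simp: order_map_def bundle_order_def)

text \<open>Both sides are homotopic to the edge whose support is the image of \<open>S\<close> in the fibre over
  \<open>supp b\<close>.\<close>
lemma fibre_edge_transport:
  assumes b: "is_simplex1 K b" and "V0 \<in> B (bd1 b)"
    and "is_simplex1 (inclusion_order (B (bd0 b))) (Simplex1 S V1 (transport b V0))"
  shows "\<exists>S' V0'. is_simplex1 (inclusion_order (B (bd1 b))) (Simplex1 S' V0' V0) \<and>
    transport b V0' = V1 \<and>
    poset_homotopic X_order (fibre_path (bd0 b) [Simplex1 S V1 (transport b V0)] @ lift [b] V0)
       (lift [b] V0' @ fibre_path (bd1 b) [Simplex1 S' V0' V0])"
proof -
  let ?e = "supp b" let ?d = "bd0 b" let ?c = "bd1 b"
  have K: "(?d, ?e) \<in> K" "(?c, ?e) \<in> K" "(?c, ?c) \<in> K" "(?d, ?d) \<in> K" "(?e, ?e) \<in> K"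
    using b base.simplex1_refl[OF b] by (auto simp: is_simplex1_def)
  have S: "S \<in> B ?d" "V1 \<in> B ?d" "V1 \<subseteq> S" "transport b V0 \<subseteq> S"
    using assms(3) by (auto simp: mem_inclusion_order)
  \<comment> \<open>The counterparts of \<open>S\<close> and \<open>V1\<close> over the other end of
    \<open>b\<close>, obtained through the fibre over \<open>?e\<close>.\<close>
  define S' where "S' = pullback ?e ?c (J ?e ?d ` S)"
  define V0' where "V0' = pullback ?e ?c (J ?e ?d ` V1)"
  have S': "S' \<in> B ?c" "J ?e ?c ` S' = J ?e ?d ` S" and V0': "V0' \<in> B ?c" "J ?e ?c ` V0' = J ?e ?d ` V1"
    using K S by (auto simp: S'_def V0'_def intro!: pullback J_image_mem)
  have "J ?e ?c ` V0' \<subseteq> J ?e ?c ` S'" using S' V0' S by auto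
  then have "V0' \<subseteq> S'" using B_order[of ?c ?e] K S' V0' by blast
  have "J ?e ?c ` V0 \<subseteq> J ?e ?c ` S'"
    using J_transport_supp[OF b assms(2)] S' S by blast
  then have "V0 \<subseteq> S'" using B_order[of ?c ?e] K S' assms(2) by blast
  have tr: "transport b V0' = V1"
    using transport_eqI[of b V0' V1 ?e] K V0' S b by simp
  have edge: "is_simplex1 (inclusion_order (B ?c)) (Simplex1 S' V0' V0)"
    using S' V0' \<open>V0' \<subseteq> S'\<close> \<open>V0 \<subseteq> S'\<close> assms(2) by (simp add: mem_inclusion_order)
  have le: "((?e, J ?e ?d ` U), (?e, J ?e ?d ` S)) \<in> X_order" if "U \<in> B ?d" "U \<subseteq> S" for U
    using that K S J_image_mem J_image_refl[of ?e] by (auto simp: mem_bundle_order FieldI1)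
  have "poset_homotopic X_order (fibre_path ?d [Simplex1 S V1 (transport b V0)] @ lift [b] V0)
       (lift [b] V0' @ fibre_path ?c [Simplex1 S' V0' V0])"
  proof (rule total.homotopic_if_common_bound[where S = "(?e, J ?e ?d ` S)"])
    show "poset_path_from_to X_order (?c, V0) (?d, V1)
        (fibre_path ?d [Simplex1 S V1 (transport b V0)] @ lift [b] V0)"
    proof (rule poset_path_from_to_appendI)
      show "poset_path_from_to X_order (?c, V0) (?d, transport b V0) (lift [b] V0)"
        using lift_from_to[of ?c ?d "[b]" V0] b assms(2) by (simp add: poset_path_from_to_single)
      show "poset_path_from_to X_order (?d, transport b V0) (?d, V1)
          (fibre_path ?d [Simplex1 S V1 (transport b V0)])"
        using K by (intro map_path_from_to[OF order_map_fibre])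
          (use assms(3) in \<open>auto simp: poset_path_from_to_single FieldI1\<close>)
    qed
    show "poset_path_from_to X_order (?c, V0) (?d, V1)
        (lift [b] V0' @ fibre_path ?c [Simplex1 S' V0' V0])"
    proof (rule poset_path_from_to_appendI)
      show "poset_path_from_to X_order (?c, V0') (?d, V1) (lift [b] V0')"
        using lift_from_to[of ?c ?d "[b]" V0'] b V0' tr by (simp add: poset_path_from_to_single)
      show "poset_path_from_to X_order (?c, V0) (?c, V0') (fibre_path ?c [Simplex1 S' V0' V0])"
        using K by (intro map_path_from_to[OF order_map_fibre])
          (use edge in \<open>auto simp: poset_path_from_to_single FieldI1\<close>)
    qed
    show "(supp x, (?e, J ?e ?d ` S)) \<in> X_order"
      if "x \<in> set (fibre_path ?d [Simplex1 S V1 (transport b V0)] @ lift [b] V0) \<union>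
        set (lift [b] V0' @ fibre_path ?c [Simplex1 S' V0' V0])" for x
    proof -
      have "supp x \<in> {(?d, S), (?e, J ?e ?c ` V0), (?e, J ?e ?c ` V0'), (?c, S')}"
        using that by auto
      moreover have "((?d, S), (?e, J ?e ?d ` S)) \<in> X_order"
          "((?c, S'), (?e, J ?e ?d ` S)) \<in> X_order"
        using K S S' J_image_mem by (auto simp: mem_bundle_order)
      moreover have "((?e, J ?e ?c ` V0), (?e, J ?e ?d ` S)) \<in> X_order"
        using le[of "transport b V0"] S J_transport_supp[OF b assms(2)] transport_mem[OF b assms(2)]
        by simp
      moreover have "((?e, J ?e ?c ` V0'), (?e, J ?e ?d ` S)) \<in> X_order"
        using le[of V1] S V0' by simp
      ultimately show ?thesis by auto
    qed
  qed
  with edge tr show ?thesis by (intro exI[of _ S'] exI[of _ V0'] conjI)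
qed

text \<open>The exchange proceeds from the end of \<open>w\<close> backwards. Each one alters the
  starting element of a lifted edge, so the rest of the lift is exchanged with the fibre edge that
  leads to the altered element.\<close>

lemma fibre_edge_transport_path:
  assumes "poset_path_from_to K x y w" and "V0 \<in> B x"
    and "is_simplex1 (inclusion_order (B y)) (Simplex1 S V1 (foldr transport w V0))"
  shows "\<exists>S' V0'. is_simplex1 (inclusion_order (B x)) (Simplex1 S' V0' V0) \<and>
    foldr transport w V0' = V1 \<and>
    poset_homotopic X_order (fibre_path y [Simplex1 S V1 (foldr transport w V0)] @ lift w V0)
       (lift w V0' @ fibre_path x [Simplex1 S' V0' V0])"
  using assms
proof (induction arbitrary: S V1 rule: poset_path_induct)
  case (single b)
  then show ?case using fibre_edge_transport[of b V0 S V1] by simp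
next
  case (Cons b w)
  let ?W = "foldr transport w V0"
  have W: "?W \<in> B (bd1 b)" using Cons.hyps(2) Cons.prems(1) by (rule transport_path_mem)
  obtain S1 W1 where 1: "is_simplex1 (inclusion_order (B (bd1 b))) (Simplex1 S1 W1 ?W)"
    "transport b W1 = V1"
    "poset_homotopic X_order (fibre_path (bd0 b) [Simplex1 S V1 (transport b ?W)] @ lift [b] ?W)
       (lift [b] W1 @ fibre_path (bd1 b) [Simplex1 S1 W1 ?W])"
    using fibre_edge_transport[OF Cons.hyps(1) W, of S V1] Cons.prems(2)
    by (auto simp del: map_append lift.simps list.map append.simps)
  obtain S' V0' where 2: "is_simplex1 (inclusion_order (B x)) (Simplex1 S' V0' V0)"
    "foldr transport w V0' = W1"
    "poset_homotopic X_order (fibre_path (bd1 b) [Simplex1 S1 W1 ?W] @ lift w V0)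
       (lift w V0' @ fibre_path x [Simplex1 S' V0' V0])"
    using Cons.IH[OF Cons.prems(1) 1(1)] by blast
  have F: "bd1 b \<in> Field K" "bd0 b \<in> Field K"
    using Cons.hyps(1) by (auto simp: is_simplex1_def intro: FieldI1)
  have lw: "poset_path_from_to X_order (x, V0) (bd1 b, ?W) (lift w V0)"
    using lift_from_to[OF Cons.hyps(2) Cons.prems(1)] .
  have f1: "poset_path_from_to X_order (bd1 b, ?W) (bd1 b, W1) (fibre_path (bd1 b) [Simplex1 S1 W1 ?W])"
    using 1(1) by (intro map_path_from_to[OF order_map_fibre] F) (auto simp: poset_path_from_to_single)
  have W1: "W1 \<in> B (bd1 b)" using 1(1) by (simp add: mem_inclusion_order)
  have lb: "poset_path_from_to X_order (bd1 b, W1) (bd0 b, V1) (lift [b] W1)"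
    using lift_from_to[of "bd1 b" "bd0 b" "[b]" W1] Cons.hyps(1) W1 1(2)
    by (simp add: poset_path_from_to_single)
  have "poset_homotopic X_order
      ((fibre_path (bd0 b) [Simplex1 S V1 (transport b ?W)] @ lift [b] ?W) @ lift w V0)
      ((lift [b] W1 @ fibre_path (bd1 b) [Simplex1 S1 W1 ?W]) @ lift w V0)"
    using poset_homotopic_append[OF equivclp_refl equivclp_sym[OF 1(3)] lw
        poset_path_from_to_appendI[OF f1 lb]] by (rule equivclp_sym)
  also have "poset_homotopic X_order \<dots>
      (lift [b] W1 @ lift w V0' @ fibre_path x [Simplex1 S' V0' V0])"
    using poset_homotopic_append[OF 2(3) equivclp_refl poset_path_from_to_appendI[OF lw f1] lb] by simp
  finally have "poset_homotopic X_order
      (fibre_path (bd0 b) [Simplex1 S V1 (foldr transport (b # w) V0)] @ lift (b # w) V0)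
      (lift (b # w) V0' @ fibre_path x [Simplex1 S' V0' V0])"
    using 2(2) by simp
  moreover have "foldr transport (b # w) V0' = V1" using 1(2) 2(2) by simp
  ultimately show ?case using 2(1) by blast
qed

lemma fibre_path_from_to:
  "a \<in> Field K \<Longrightarrow> poset_path_from_to (inclusion_order (B a)) U V F \<Longrightarrow>
    poset_path_from_to X_order (a, U) (a, V) (fibre_path a F)"
  by (rule map_path_from_to[OF order_map_fibre])

text \<open>The first factor is the horizontal edge that lies over the same edge of \<open>K\<close> as \<open>b\<close> and ends where
  \<open>b\<close> ends; the second one corrects the starting point inside the fibre.\<close>
lemma edge_decomposition:
  assumes b: "is_simplex1 X_order b" and "bd1 b = (c, V0)" and "bd0 b = (d, W)"
  shows "\<exists>S V1. is_simplex1 (inclusion_order (B c)) (Simplex1 S V1 V0) \<and>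
    transport (map_simplex1 fst b) V1 = W \<and>
    poset_homotopic X_order [b]
      (lift [map_simplex1 fst b] V1 @ fibre_path c [Simplex1 S V1 V0])"
proof -
  obtain e S0 where e: "supp b = (e, S0)" by (cases "supp b")
  have K: "(d, e) \<in> K" "(c, e) \<in> K" and S0: "S0 \<in> B e" "W \<in> B d" "V0 \<in> B c"
    "J e d ` W \<subseteq> S0" "J e c ` V0 \<subseteq> S0"
    using assms e by (auto simp: is_simplex1_def mem_bundle_order)
  have F: "e \<in> Field K" "c \<in> Field K" using K by (auto intro: FieldI1 FieldI2)
  let ?b = "map_simplex1 fst b"
  have b': "is_simplex1 K ?b" using K assms e by (simp add: is_simplex1_def)
  define S where "S = pullback e c S0"
  define V1 where "V1 = pullback e c (J e d ` W)"
  have S: "S \<in> B c" "J e c ` S = S0" and V1: "V1 \<in> B c" "J e c ` V1 = J e d ` W"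
    using K S0 by (auto simp: S_def V1_def intro!: pullback J_image_mem)
  have sub: "V1 \<subseteq> S" "V0 \<subseteq> S"
    using B_order[OF K(2)] S V1 S0 by metis+
  have tr: "transport ?b V1 = W"
    using transport_eqI[OF b', of V1 W e] V1 S0 assms e Field_refl[OF F(1)] by simp
  have edge: "is_simplex1 (inclusion_order (B c)) (Simplex1 S V1 V0)"
    using S V1 S0 sub by (simp add: mem_inclusion_order)
  have "poset_homotopic X_order [b] (lift [?b] V1 @ fibre_path c [Simplex1 S V1 V0])"
  proof (rule total.homotopic_if_common_bound[where S = "(e, S0)"])
    show "poset_path_from_to X_order (c, V0) (d, W) [b]"
      using assms by (simp add: poset_path_from_to_single)
    show "poset_path_from_to X_order (c, V0) (d, W) (lift [?b] V1 @ fibre_path c [Simplex1 S V1 V0])"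
    proof (rule poset_path_from_to_appendI)
      show "poset_path_from_to X_order (c, V0) (c, V1) (fibre_path c [Simplex1 S V1 V0])"
        by (intro fibre_path_from_to F) (use edge in \<open>auto simp: poset_path_from_to_single\<close>)
      show "poset_path_from_to X_order (c, V1) (d, W) (lift [?b] V1)"
        using lift_from_to[of c d "[?b]" V1] b' V1 tr assms by (simp add: poset_path_from_to_single)
    qed
    show "(supp x, (e, S0)) \<in> X_order"
      if "x \<in> set [b] \<union> set (lift [?b] V1 @ fibre_path c [Simplex1 S V1 V0])" for x
    proof -
      have "supp x \<in> {(e, S0), (e, J e c ` V1), (c, S)}"
        using that assms e by auto
      moreover have "((e, S0), (e, S0)) \<in> X_order" "((c, S), (e, S0)) \<in> X_order"
        using K S S0 F by (simp_all add: mem_bundle_order J_image_refl Field_refl)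
      moreover have "((e, J e c ` V1), (e, S0)) \<in> X_order"
        using K V1 S0 F J_image_mem by (simp add: mem_bundle_order J_image_refl Field_refl)
      ultimately show ?thesis by auto
    qed
  qed
  with edge tr show ?thesis by blast
qed

text \<open>The final edge is split by \<open>edge_decomposition\<close>; its fibre part lies over
  the end of the preceding lift and is pushed back to the fibre over \<open>a\<close>. The lift
  already found thereby gets a new starting element, which is why \<open>U'\<close> is existentially
  quantified.\<close>

lemma path_decomposition:
  assumes "poset_path_from_to X_order (a, U) y w"
  shows "\<exists>F U'. poset_path_from_to (inclusion_order (B a)) U U' F \<and>
    foldr transport (map (map_simplex1 fst) w) U' = snd y \<and>
    poset_homotopic X_order w (lift (map (map_simplex1 fst) w) U' @ fibre_path a F)"
  using assms
proof (induction rule: poset_path_induct)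
  case (single b)
  from edge_decomposition[OF single.hyps(1,2), of "fst (bd0 b)" "snd (bd0 b)"]
  obtain S V1 where "is_simplex1 (inclusion_order (B a)) (Simplex1 S V1 U)"
      "transport (map_simplex1 fst b) V1 = snd (bd0 b)"
      "poset_homotopic X_order [b] (lift [map_simplex1 fst b] V1 @ fibre_path a [Simplex1 S V1 U])"
    by auto
  then show ?case
    by (intro exI[of _ "[Simplex1 S V1 U]"] exI[of _ V1]) (simp add: poset_path_from_to_single)
next
  case (Cons b w)
  let ?b = "map_simplex1 fst b" and ?w = "map (map_simplex1 fst) w"
  obtain c V0 where c: "bd1 b = (c, V0)" by (cases "bd1 b")
  obtain F U0 where F: "poset_path_from_to (inclusion_order (B a)) U U0 F"
      "foldr transport ?w U0 = V0" "poset_homotopic X_order w (lift ?w U0 @ fibre_path a F)"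
    using Cons.IH c by auto
  obtain S V1 where 1: "is_simplex1 (inclusion_order (B c)) (Simplex1 S V1 V0)"
      "transport ?b V1 = snd (bd0 b)"
      "poset_homotopic X_order [b] (lift [?b] V1 @ fibre_path c [Simplex1 S V1 V0])"
    using edge_decomposition[OF Cons.hyps(1) c, of "fst (bd0 b)" "snd (bd0 b)"] by auto
  have w: "poset_path_from_to K a c ?w"
    using map_path_from_to[OF order_map_fst Cons.hyps(2)] c by simp
  have U0: "U0 \<in> B a" using inclusion_path_ends[OF F(1)] by simp
  obtain S' U1 where 2: "is_simplex1 (inclusion_order (B a)) (Simplex1 S' U1 U0)"
    "foldr transport ?w U1 = V1"
    "poset_homotopic X_order (fibre_path c [Simplex1 S V1 V0] @ lift ?w U0)
       (lift ?w U1 @ fibre_path a [Simplex1 S' U1 U0])"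
    using fibre_edge_transport_path[OF w U0] 1(1) F(2) by blast
  let ?F = "Simplex1 S' U1 U0 # F"
  have a: "a \<in> Field K" and c': "c \<in> Field K"
    using base.path_ends_refl[OF w] by (auto intro: FieldI1)
  have V1: "V1 \<in> B c" using 1(1) by (simp add: mem_inclusion_order)
  have b: "is_simplex1 K ?b" "bd1 ?b = c"
    using Cons.hyps(1) c order_map_fst by (auto simp: is_simplex1_def order_map_def)
  have ftF: "poset_path_from_to (inclusion_order (B a)) U U1 ?F"
    using F(1) 2(1) by (auto simp: poset_path_from_to_Cons dest: poset_path_from_to_nonempty)
  have f1: "poset_path_from_to X_order (a, U) (a, U0) (fibre_path a F)"
    by (rule fibre_path_from_to[OF a F(1)])
  have f2: "poset_path_from_to X_order (a, U0) (c, V0) (lift ?w U0)"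
    using lift_from_to[OF w U0] F(2) by simp
  have f3: "poset_path_from_to X_order (c, V0) (c, V1) (fibre_path c [Simplex1 S V1 V0])"
    by (intro fibre_path_from_to c') (use 1(1) in \<open>simp add: poset_path_from_to_single\<close>)
  have f4: "poset_path_from_to X_order (c, V1) (bd0 b) (lift [?b] V1)"
    using lift_from_to[of c "bd0 ?b" "[?b]" V1] b V1 1(2) by (simp add: poset_path_from_to_single)
  have fb: "poset_path_from_to X_order (c, V0) (bd0 b) [b]"
    using Cons.hyps(1) c by (simp add: poset_path_from_to_single)
  have fw: "poset_path_from_to X_order (a, U) (c, V0) w"
    using Cons.hyps(2) c by simp
  have "poset_homotopic X_order ([b] @ w)
      ((lift [?b] V1 @ fibre_path c [Simplex1 S V1 V0]) @ (lift ?w U0 @ fibre_path a F))"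
    by (rule poset_homotopic_append[OF F(3) 1(3) fw fb])
  moreover have "poset_homotopic X_order
      ((fibre_path c [Simplex1 S V1 V0] @ lift ?w U0) @ fibre_path a F)
      ((lift ?w U1 @ fibre_path a [Simplex1 S' U1 U0]) @ fibre_path a F)"
    by (rule poset_homotopic_append[OF equivclp_refl 2(3) f1 poset_path_from_to_appendI[OF f2 f3]])
  from poset_homotopic_append[OF this equivclp_refl
      poset_path_from_to_appendI[OF f1 poset_path_from_to_appendI[OF f2 f3]] f4]
  have "poset_homotopic X_order
     ((lift [?b] V1 @ fibre_path c [Simplex1 S V1 V0]) @ (lift ?w U0 @ fibre_path a F))
     (lift [?b] V1 @ lift ?w U1 @ fibre_path a ?F)"
    by simp
  ultimately have "poset_homotopic X_order ([b] @ w) (lift [?b] V1 @ lift ?w U1 @ fibre_path a ?F)"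
    by (rule equivclp_trans)
  then have "poset_homotopic X_order (b # w) (lift (map (map_simplex1 fst) (b # w)) U1 @ fibre_path a ?F)"
    using 2(2) by simp
  moreover have "foldr transport (map (map_simplex1 fst) (b # w)) U1 = snd (bd0 b)"
    using 2(2) 1(2) by simp
  ultimately show ?case using ftF by blast
qed

section \<open>Exactness for the poset of the fibre\<close>

lemma fst_fibre_path: "map (map_simplex1 fst) (fibre_path a F) = map (map_simplex1 (\<lambda>_. a)) F"
  by (simp add: simplex1.map_comp comp_def)

lemma fst_lift: "map (map_simplex1 fst) (lift w V) = w"
  by (induction w) (auto intro: simplex1.expand)

text \<open>All supports equal \<open>a\<close>. For fibre paths this puts the image into the
  kernel, and it shows that closing up in the fibre does not change the class of the
  projection.\<close>

lemma constant_path_homotopic: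
  assumes "a \<in> Field K" "poset_path_from_to P U V F"
  shows "poset_homotopic K (map (map_simplex1 (\<lambda>_. a)) F) [Simplex1 a a a]"
proof (rule base.contract_path)
  show "poset_path_from_to K a a (map (map_simplex1 (\<lambda>_. a)) F)"
    using assms(2)
    by (intro map_path_from_to[of P K "\<lambda>_. a"]) (simp_all add: order_map_def Field_refl assms(1) split_def)
qed (use Field_refl[OF assms(1)] in auto)

text \<open>The fibre part of the decomposition need not look closed. Null-homotopy of the
  projection makes its holonomy fix \<open>U'\<close>, and the lift ends at \<open>U\<close>, so it
  starts there as well.\<close>

lemma fst_null_homotopic_imp_fibre:
  assumes "poset_path_from_to X_order (a, U) (a, U) w"
    and "poset_homotopic K (map (map_simplex1 fst) w) [Simplex1 a a a]"
  shows "\<exists>F. poset_path_from_to (inclusion_order (B a)) U U F \<and>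
    poset_homotopic X_order w (fibre_path a F)"
proof -
  let ?w = "map (map_simplex1 fst) w" and ?e = "Simplex1 a a a"
  obtain F U' where F: "poset_path_from_to (inclusion_order (B a)) U U' F"
    "foldr transport ?w U' = U" "poset_homotopic X_order w (lift ?w U' @ fibre_path a F)"
    using path_decomposition[OF assms(1)] by auto
  have U': "U' \<in> B a" using inclusion_path_ends[OF F(1)] by simp
  have w: "poset_path_from_to K a a ?w"
    using map_path_from_to[OF order_map_fst assms(1)] by simp
  then have aa: "(a, a) \<in> K" and a: "a \<in> Field K"
    using poset_homotopic_from_to[OF assms(2), of a a]
    by (auto simp: poset_path_from_to_single intro: FieldI1)
  have h: "poset_homotopic X_order (lift ?w U') (lift [?e] U')"
    and "foldr transport ?w U' = foldr transport [?e] U'"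
    using lift_homotopic[OF assms(2) w U'] by auto
  moreover have "transport ?e U' = U'"
    using transport_eqI[of ?e U' U' a] aa U' by simp
  ultimately have "U' = U" and le: "lift [?e] U = [Simplex1 (a, U) (a, U) (a, U)]"
    using F(2) J_image_refl[OF a U'] by auto
  have ft: "poset_path_from_to X_order (a, U) (a, U) (fibre_path a F)"
    using fibre_path_from_to[OF a F(1)] \<open>U' = U\<close> by simp
  have "poset_path_from_to X_order (a, U) (a, U) (lift ?w U')"
    using lift_from_to[OF w U'] F(2) \<open>U' = U\<close> by simp
  from poset_homotopic_append[OF equivclp_refl h ft this]
  have "poset_homotopic X_order (lift ?w U' @ fibre_path a F) (Simplex1 (a, U) (a, U) (a, U) # fibre_path a F)"
    using le \<open>U' = U\<close> by simp
  also have "poset_homotopic X_order \<dots> (fibre_path a F)"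
    using ft by (rule total.id_left)
  finally show ?thesis using F(1,3) \<open>U' = U\<close> equivclp_trans by metis
qed

text \<open>The closing path \<open>F\<close> projects to degenerate edges and leaves the class
  below unchanged. Connectedness is a hypothesis because it comes from the topology of the
  fibre.\<close>

lemma lift_loop:
  assumes "a \<in> Field K" "U \<in> B a" "poset_path_from_to K a a w"
    and conn: "\<And>V. V \<in> B a \<Longrightarrow> \<exists>F. poset_path_from_to (inclusion_order (B a)) V U F"
  shows "\<exists>v. poset_path_from_to X_order (a, U) (a, U) v \<and>
    poset_homotopic K (map (map_simplex1 fst) v) w"
proof -
  let ?V = "foldr transport w U"
  obtain F where F: "poset_path_from_to (inclusion_order (B a)) ?V U F"
    using conn transport_path_mem[OF assms(3,2)] by blast
  let ?v = "fibre_path a F @ lift w U"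
  have v: "poset_path_from_to X_order (a, U) (a, U) ?v"
    using lift_from_to[OF assms(3,2)] fibre_path_from_to[OF assms(1) F]
    by (rule poset_path_from_to_appendI)
  have eq: "map (map_simplex1 fst) ?v = map (map_simplex1 (\<lambda>_. a)) F @ w"
    by (simp only: map_append fst_fibre_path fst_lift)
  have 1: "poset_homotopic K (map (map_simplex1 (\<lambda>_. a)) F) [Simplex1 a a a]"
    using constant_path_homotopic[OF assms(1) F] .
  have "poset_path_from_to K a a (map (map_simplex1 (\<lambda>_. a)) F)"
    using poset_homotopic_from_to[OF 1, of a a] Field_refl[OF assms(1)]
    by (simp add: poset_path_from_to_single)
  from poset_homotopic_append[OF equivclp_refl 1 assms(3) this]
  have "poset_homotopic K (map (map_simplex1 (\<lambda>_. a)) F @ w) (Simplex1 a a a # w)" by simp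
  also have "poset_homotopic K \<dots> w" using assms(3) by (rule base.id_left)
  finally have "poset_homotopic K (map (map_simplex1 fst) ?v) w" by (simp only: eq)
  with v show ?thesis by blast
qed

text \<open>The combinatorial core: the fibre enters through its poset, and the topological group is
  brought in later by \<open>base_identification_iso\<close>.\<close>

theorem exact_at_total_space:
  assumes "a \<in> Field K" "U \<in> B a"
  shows "exact_at (poset_pi1 (inclusion_order (B a)) U) (poset_pi1 X_order (a, U)) (poset_pi1 K a)
    (poset_pi1_map X_order (Pair a)) (poset_pi1_map K fst)"
proof -
  let ?C = "inclusion_order (B a)"
  interpret fib: preordering ?C by (rule preordering_inclusion_order)
  have U: "(U, U) \<in> ?C" "((a, U), (a, U)) \<in> X_order"
    using assms by (simp_all add: mem_inclusion_order mem_bundle_order J_image_refl Field_refl)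
  interpret i: group_hom "poset_pi1 ?C U" "poset_pi1 X_order (a, U)" "poset_pi1_map X_order (Pair a)"
    using U assms poset_pi1_map_hom[OF order_map_fibre, of a U]
    by (auto simp: group_hom_def group_hom_axioms_def intro: fib.group_poset_pi1 total.group_poset_pi1)
  interpret e: group_hom "poset_pi1 X_order (a, U)" "poset_pi1 K a" "poset_pi1_map K fst"
    using U assms poset_pi1_map_hom[OF order_map_fst, of "(a, U)"] Field_refl[OF assms(1)]
    by (auto simp: group_hom_def group_hom_axioms_def intro: base.group_poset_pi1 total.group_poset_pi1)
  have "poset_pi1_map X_order (Pair a) ` carrier (poset_pi1 ?C U) =
      kernel (poset_pi1 X_order (a, U)) (poset_pi1 K a) (poset_pi1_map K fst)"
  proof (intro equalityI subsetI)
    fix x assume "x \<in> poset_pi1_map X_order (Pair a) ` carrier (poset_pi1 ?C U)"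
    then obtain F where F: "poset_path_from_to ?C U U F"
      "x = poset_pi1_map X_order (Pair a) (poset_homotopy_class ?C F)"
      by (auto simp: carrier_poset_pi1 poset_loops_def)
    then have x: "x = poset_homotopy_class X_order (fibre_path a F)"
      by (simp add: poset_pi1_map_class[OF order_map_fibre[OF assms(1)]])
    have "fibre_path a F \<in> poset_loops X_order (a, U)"
      using fibre_path_from_to[OF assms(1) F(1)] by (simp add: poset_loops_def)
    moreover have "poset_pi1_map K fst x = \<one>\<^bsub>poset_pi1 K a\<^esub>"
      using constant_path_homotopic[OF assms(1) F(1)]
      by (simp only: x poset_pi1_map_class[OF order_map_fst] fst_fibre_path one_poset_pi1 poset_homotopy_class_eq)
    ultimately show "x \<in> kernel (poset_pi1 X_order (a, U)) (poset_pi1 K a) (poset_pi1_map K fst)"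
      by (simp add: kernel_def carrier_poset_pi1 x)
  next
    fix x assume "x \<in> kernel (poset_pi1 X_order (a, U)) (poset_pi1 K a) (poset_pi1_map K fst)"
    then obtain w where w: "poset_path_from_to X_order (a, U) (a, U) w"
      "x = poset_homotopy_class X_order w"
      and "poset_pi1_map K fst x = \<one>\<^bsub>poset_pi1 K a\<^esub>"
      by (auto simp: kernel_def carrier_poset_pi1 poset_loops_def)
    then have "poset_homotopic K (map (map_simplex1 fst) w) [Simplex1 a a a]"
      by (simp add: poset_pi1_map_class[OF order_map_fst] one_poset_pi1 poset_homotopy_class_eq)
    from fst_null_homotopic_imp_fibre[OF w(1) this]
    obtain F where "poset_path_from_to ?C U U F" "poset_homotopic X_order w (fibre_path a F)"
      by blast
    then have "x = poset_pi1_map X_order (Pair a) (poset_homotopy_class ?C F)"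
      "poset_homotopy_class ?C F \<in> carrier (poset_pi1 ?C U)"
      by (auto simp: w(2) poset_pi1_map_class[OF order_map_fibre[OF assms(1)]] poset_homotopy_class_eq
          carrier_poset_pi1 poset_loops_def)
    then show "x \<in> poset_pi1_map X_order (Pair a) ` carrier (poset_pi1 ?C U)" by blast
  qed
  then show ?thesis
    using i.group_hom_axioms e.group_hom_axioms by (simp add: exact_at_def)
qed

text \<open>The kernel of the constant map is the whole group, so exactness here is surjectivity of
  the projection.\<close>

theorem exact_at_base:
  assumes "a \<in> Field K" "U \<in> B a"
    and conn: "\<And>V. V \<in> B a \<Longrightarrow> \<exists>F. poset_path_from_to (inclusion_order (B a)) V U F"
  shows "exact_at (poset_pi1 X_order (a, U)) (poset_pi1 K a) (singleton_group ())
    (poset_pi1_map K fst) (\<lambda>_. ())"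
proof -
  interpret e: group_hom "poset_pi1 X_order (a, U)" "poset_pi1 K a" "poset_pi1_map K fst"
    using exact_at_total_space[OF assms(1,2)] by (simp add: exact_at_def)
  have "group_hom (poset_pi1 K a) (singleton_group ()) (\<lambda>_. ())"
  proof (intro group_hom.intro group_hom_axioms.intro)
    show "(\<lambda>_. ()) \<in> hom (poset_pi1 K a) (singleton_group ())"
      by (simp add: hom_def singleton_group_def)
  qed auto
  moreover have "poset_pi1_map K fst ` carrier (poset_pi1 X_order (a, U)) = carrier (poset_pi1 K a)"
  proof (intro equalityI subsetI)
    fix x assume "x \<in> carrier (poset_pi1 K a)"
    then obtain w where w: "poset_path_from_to K a a w" "x = poset_homotopy_class K w"
      by (auto simp: carrier_poset_pi1 poset_loops_def)
    obtain v where v: "poset_path_from_to X_order (a, U) (a, U) v"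
        "poset_homotopic K (map (map_simplex1 fst) v) w"
      using lift_loop[OF assms(1,2) w(1) conn] by blast
    then have "x = poset_pi1_map K fst (poset_homotopy_class X_order v)"
      by (simp add: w poset_pi1_map_class[OF order_map_fst] poset_homotopy_class_eq equivclp_sym)
    with v(1) show "x \<in> poset_pi1_map K fst ` carrier (poset_pi1 X_order (a, U))"
      by (auto simp: carrier_poset_pi1 poset_loops_def)
  qed auto
  ultimately show ?thesis
    using e.group_hom_axioms by (simp add: exact_at_def kernel_def singleton_group_def)
qed

end

section \<open>Path homotopy in abstract topological spaces\<close>

definition path_from_to :: "'a topology \<Rightarrow> 'a \<Rightarrow> 'a \<Rightarrow> (real \<Rightarrow> 'a) \<Rightarrow> bool" where
  "path_from_to X x y g \<longleftrightarrow> pathin X g \<and> g 0 = x \<and> g 1 = y"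

definition path_homotopic ::
    "'a topology \<Rightarrow> 'a \<Rightarrow> 'a \<Rightarrow> (real \<Rightarrow> 'a) \<Rightarrow> (real \<Rightarrow> 'a) \<Rightarrow> bool" where
  "path_homotopic X x y g h \<longleftrightarrow>
    homotopic_with (\<lambda>r. r 0 = x \<and> r 1 = y) (top_of_set {0..1}) X g h"

abbreviation unit_interval :: "real topology" where
  "unit_interval \<equiv> top_of_set {0..1}"

text \<open>Paths are the curves homotopic to themselves; continuity facts such as
  \<open>path_from_to_join\<close> are thus read off from facts on homotopies.\<close>

lemma path_homotopic_refl: "path_homotopic X x y g g \<longleftrightarrow> path_from_to X x y g"
  by (simp add: path_homotopic_def path_from_to_def pathin_def)

lemma path_homotopic_sym: "path_homotopic X x y g h \<Longrightarrow> path_homotopic X x y h g"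
  unfolding path_homotopic_def by (rule homotopic_with_symD)

lemma path_homotopic_trans [trans]:
  "path_homotopic X x y f g \<Longrightarrow> path_homotopic X x y g h \<Longrightarrow> path_homotopic X x y f h"
  unfolding path_homotopic_def by (rule homotopic_with_trans)

lemma path_homotopic_from_to:
  assumes "path_homotopic X x y g h"
  shows "path_from_to X x y g" "path_from_to X x y h"
  using homotopic_with_imp_continuous_maps[OF assms[unfolded path_homotopic_def]]
    homotopic_with_imp_property[OF assms[unfolded path_homotopic_def]]
  by (auto simp: path_from_to_def pathin_def)

text \<open>Curves are total functions, and their values outside the unit interval carry no
  meaning.\<close>

lemma path_homotopic_eq:
  assumes "path_from_to X x y g" "\<And>t. t \<in> {0..1} \<Longrightarrow> g t = h t"
  shows "path_homotopic X x y g h"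
  using assms unfolding path_homotopic_def
  by (intro homotopic_with_equal) (auto simp: path_from_to_def pathin_def)

lemma path_from_to_continuous_on:
  "path_from_to (top_of_set S) u v \<theta> \<longleftrightarrow>
    continuous_on {0..1} \<theta> \<and> \<theta> ` {0..1} \<subseteq> S \<and> \<theta> 0 = u \<and> \<theta> 1 = v"
  by (auto simp: path_from_to_def pathin_def)

text \<open>The unit interval is convex, so two reparametrizations with the same ends are joined by
  a straight homotopy. The unit, inverse and associativity laws all reduce to this.\<close>

lemma path_homotopic_reparametrize:
  assumes "pathin X p" "path_from_to unit_interval u v \<theta>" "path_from_to unit_interval u v \<theta>'"
  shows "path_homotopic X (p u) (p v) (p \<circ> \<theta>) (p \<circ> \<theta>')"
proof -
  have c: "continuous_on {0..1} \<theta>" "continuous_on {0..1} \<theta>'" "\<theta> 0 = u" "\<theta> 1 = v" "\<theta>' 0 = u"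
      "\<theta>' 1 = v" "\<theta> ` {0..1} \<subseteq> {0..1}" "\<theta>' ` {0..1} \<subseteq> {0..1}"
    using assms by (auto simp: path_from_to_continuous_on)
  have "homotopic_paths {0..1} \<theta> \<theta>'"
    using c by (intro homotopic_paths_linear)
      (auto simp: path_def pathstart_def pathfinish_def closed_segment_subset image_subset_iff)
  then have "path_homotopic unit_interval u v \<theta> \<theta>'"
    using c by (simp add: path_homotopic_def homotopic_paths_def pathstart_def pathfinish_def)
  then show ?thesis
    using assms(1) unfolding path_homotopic_def
    by (elim homotopic_with_compose_continuous_map_left) (auto simp: pathin_def)
qed

lemma pathin_compose_interval:
  assumes "pathin X p" "path_from_to unit_interval u v \<theta>"
  shows "path_from_to X (p u) (p v) (p \<circ> \<theta>)"
  using path_homotopic_reparametrize[OF assms assms(2)] by (rule path_homotopic_refl[THEN iffD1])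

lemma path_homotopic_join:
  assumes "path_homotopic X x y g g'" "path_homotopic X y z h h'"
  shows "path_homotopic X x z (top_join g h) (top_join g' h')"
proof -
  let ?Q = "prod_topology unit_interval unit_interval"
  obtain H1 where H1: "continuous_map ?Q X H1" "\<And>s. H1 (0, s) = g s" "\<And>s. H1 (1, s) = g' s"
      "\<And>t. t \<in> {0..1} \<Longrightarrow> H1 (t, 0) = x \<and> H1 (t, 1) = y"
    using assms(1) unfolding path_homotopic_def homotopic_with_def by auto
  obtain H2 where H2: "continuous_map ?Q X H2" "\<And>s. H2 (0, s) = h s" "\<And>s. H2 (1, s) = h' s"
      "\<And>t. t \<in> {0..1} \<Longrightarrow> H2 (t, 0) = y \<and> H2 (t, 1) = z"
    using assms(2) unfolding path_homotopic_def homotopic_with_def by auto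
  let ?H = "\<lambda>u. if snd u \<le> 1 / 2 then (H1 \<circ> (\<lambda>u. (fst u, 2 * snd u))) u
                 else (H2 \<circ> (\<lambda>u. (fst u, 2 * snd u - 1))) u"
  \<comment> \<open>The square as a subspace of the plane, where continuity of the affine maps is
    known.\<close>
  have Q: "?Q = top_of_set ({0..1} \<times> {0..1})"
    by (simp add: prod_topology_subtopology(1) subtopology_subtopology Times_Int_Times
        flip: euclidean_product_topology) (simp add: prod_topology_subtopology subtopology_subtopology Times_Int_Times)
  have "continuous_map ?Q X ?H"
  proof (rule continuous_map_cases_le)
    show "continuous_map ?Q euclideanreal snd" "continuous_map ?Q euclideanreal (\<lambda>u. 1 / 2)"
      unfolding Q by (auto intro!: continuous_intros)
    show "continuous_map (subtopology ?Q {u \<in> topspace ?Q. snd u \<le> 1 / 2}) X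
        (H1 \<circ> (\<lambda>u. (fst u, 2 * snd u)))"
      by (rule continuous_map_compose[OF _ H1(1)])
        (auto simp: Q subtopology_subtopology intro!: continuous_intros)
    show "continuous_map (subtopology ?Q {u \<in> topspace ?Q. 1 / 2 \<le> snd u}) X
        (H2 \<circ> (\<lambda>u. (fst u, 2 * snd u - 1)))"
      by (rule continuous_map_compose[OF _ H2(1)])
        (auto simp: Q subtopology_subtopology intro!: continuous_intros)
    show "(H1 \<circ> (\<lambda>u. (fst u, 2 * snd u))) u = (H2 \<circ> (\<lambda>u. (fst u, 2 * snd u - 1))) u"
      if "u \<in> topspace ?Q" "snd u = 1 / 2" for u
      proof -
      \<comment> \<open>Along the seam both homotopies have the constant value
        \<open>y\<close>.\<close>
      have "2 * snd u = 1" "fst u \<in> {0..1}" using that by auto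
      then show ?thesis using H1(4) H2(4) by simp
    qed
  qed
  moreover have "?H (0, s) = top_join g h s" "?H (1, s) = top_join g' h' s" for s
    by (auto simp: top_join_def H1 H2)
  ultimately show ?thesis
    unfolding path_homotopic_def homotopic_with_def
    by (intro exI[of _ ?H]) (auto simp: H1(4) H2(4))
qed

lemma path_from_to_join:
  "path_from_to X x y g \<Longrightarrow> path_from_to X y z h \<Longrightarrow> path_from_to X x z (top_join g h)"
  using path_homotopic_join by (metis path_homotopic_refl)

lemma top_join_compose: "top_join (p \<circ> \<theta>) (p \<circ> \<theta>') = p \<circ> top_join \<theta> \<theta>'"
  by (auto simp: top_join_def fun_eq_iff)

text \<open>No order of \<open>u\<close> and \<open>v\<close> is assumed:
  \<open>p \<circ> linear_path 1 0\<close> is the reverse of \<open>p\<close>, and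
  \<open>u = v\<close> gives a constant path.\<close>

definition linear_path :: "real \<Rightarrow> real \<Rightarrow> real \<Rightarrow> real" where
  "linear_path u v t = u + t * (v - u)"

lemma path_from_to_linear_path:
  assumes "u \<in> {0..1}" "v \<in> {0..1}"
  shows "path_from_to unit_interval u v (linear_path u v)"
proof -
  have "linear_path u v t \<in> {0..1}" if "t \<in> {0..1}" for t
    using convexD_alt[of "{0..1}" u v t] assms that
    by (simp add: linear_path_def algebra_simps)
  then show ?thesis
    unfolding path_from_to_continuous_on
    by (auto simp: linear_path_def[abs_def] intro!: continuous_intros)
qed

lemma linear_path_0_1 [simp]: "p \<circ> linear_path 0 1 = p"
  by (simp add: linear_path_def fun_eq_iff)

lemma linear_path_same [simp]: "p \<circ> linear_path u u = (\<lambda>_. p u)"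
  by (simp add: linear_path_def fun_eq_iff)

text \<open>The times need not increase: \<open>0 0 1\<close> and \<open>0 1 1\<close> give the unit
  laws, \<open>0 1 0\<close> and \<open>1 0 1\<close> the inverse laws.\<close>

lemma path_homotopic_subpaths:
  assumes "pathin X p" "s \<in> {0..1}" "t \<in> {0..1}" "u \<in> {0..1}"
  shows "path_homotopic X (p s) (p u) (top_join (p \<circ> linear_path s t) (p \<circ> linear_path t u))
           (p \<circ> linear_path s u)"
  unfolding top_join_compose
  using assms path_homotopic_reparametrize path_from_to_join path_from_to_linear_path by metis

lemma path_homotopic_const_left:
  "path_from_to X x y p \<Longrightarrow> path_homotopic X x y (top_join (\<lambda>_. x) p) p"
  using path_homotopic_subpaths[of X p 0 0 1] by (auto simp: path_from_to_def)

lemma path_homotopic_const_right: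
  "path_from_to X x y p \<Longrightarrow> path_homotopic X x y (top_join p (\<lambda>_. y)) p"
  using path_homotopic_subpaths[of X p 0 1 1] by (auto simp: path_from_to_def)

lemma path_homotopic_inverse_right:
  "path_from_to X x y p \<Longrightarrow> path_homotopic X x x (top_join p (p \<circ> linear_path 1 0)) (\<lambda>_. x)"
  using path_homotopic_subpaths[of X p 0 1 0] by (auto simp: path_from_to_def)

lemma path_homotopic_inverse_left:
  "path_from_to X x y p \<Longrightarrow> path_homotopic X y y (top_join (p \<circ> linear_path 1 0) p) (\<lambda>_. y)"
  using path_homotopic_subpaths[of X p 1 0 1] by (auto simp: path_from_to_def)

lemma path_from_to_reverse:
  "path_from_to X x y p \<Longrightarrow> path_from_to X y x (p \<circ> linear_path 1 0)"
  using pathin_compose_interval[OF _ path_from_to_linear_path[of 1 0], of X p]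
  by (auto simp: path_from_to_def)

lemma path_homotopic_assoc:
  assumes "path_from_to X w x p" "path_from_to X x y q" "path_from_to X y z r"
  shows "path_homotopic X w z (top_join (top_join p q) r) (top_join p (top_join q r))"
proof -
  define P where "P = top_join p (top_join q r)"
  \<comment> \<open>\<open>P\<close> runs through \<open>p\<close>, \<open>q\<close> and
    \<open>r\<close> on [0, 1/2], [1/2, 3/4] and [3/4, 1].\<close>
  let ?a = "linear_path 0 (1/2)" and ?b = "linear_path (1/2) (3/4)" and ?c = "linear_path (3/4) 1"
  have P: "path_from_to X w z P"
    unfolding P_def using assms path_from_to_join by metis
  have "path_homotopic X w x p (P \<circ> ?a)" "path_homotopic X x y q (P \<circ> ?b)"
      "path_homotopic X y z r (P \<circ> ?c)"
    using assms
    by (intro path_homotopic_eq; force simp: P_def top_join_def linear_path_def path_from_to_def)+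
  then have "path_homotopic X w z (top_join (top_join p q) r) (P \<circ> top_join (top_join ?a ?b) ?c)"
    unfolding top_join_compose[symmetric] by (intro path_homotopic_join)
  also have "path_homotopic X (P 0) (P 1) \<dots> (P \<circ> linear_path 0 1)"
    using P path_from_to_join[OF path_from_to_join[OF path_from_to_linear_path
          path_from_to_linear_path] path_from_to_linear_path, of 0 "1/2" "3/4" 1]
    by (intro path_homotopic_reparametrize path_from_to_linear_path) (auto simp: path_from_to_def)
  then have "path_homotopic X w z (P \<circ> top_join (top_join ?a ?b) ?c) P"
    using P by (simp add: path_from_to_def)
  finally show ?thesis by (simp add: P_def)
qed

section \<open>The topological fundamental group\<close>

lemma mem_top_homotopy_class: "h \<in> top_homotopy_class X x g \<longleftrightarrow> path_homotopic X x x g h"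
  by (simp add: top_homotopy_class_def path_homotopic_def)

lemma mem_top_loops: "g \<in> top_loops X x \<longleftrightarrow> path_from_to X x x g"
  by (simp add: top_loops_def path_from_to_def)

lemma top_homotopy_class_eq:
  assumes "g \<in> top_loops X x"
  shows "top_homotopy_class X x g = top_homotopy_class X x h \<longleftrightarrow> path_homotopic X x x g h"
proof
  have g: "path_homotopic X x x g g"
    using assms by (simp add: mem_top_loops path_homotopic_refl)
  show "path_homotopic X x x g h" if "top_homotopy_class X x g = top_homotopy_class X x h"
    using g that path_homotopic_sym unfolding set_eq_iff mem_top_homotopy_class by metis
  show "top_homotopy_class X x g = top_homotopy_class X x h" if "path_homotopic X x x g h"
    using path_homotopic_trans that path_homotopic_sym[OF that]
    unfolding set_eq_iff mem_top_homotopy_class by metis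
qed

lemma top_pi1_mult:
  assumes "g \<in> top_loops X x" "h \<in> top_loops X x"
  shows "top_homotopy_class X x h \<otimes>\<^bsub>top_pi1 X x\<^esub> top_homotopy_class X x g =
    top_homotopy_class X x (top_join g h)"
proof -
  have "top_homotopy_class X x (top_join g' h') = top_homotopy_class X x (top_join g h)"
    if "h' \<in> top_homotopy_class X x h" "g' \<in> top_homotopy_class X x g" for g' h'
  proof -
    have "path_homotopic X x x (top_join g h) (top_join g' h')"
      using that by (simp add: mem_top_homotopy_class path_homotopic_join)
    then show ?thesis
      by (metis mem_top_loops path_homotopic_from_to(1) top_homotopy_class_eq)
  qed
  moreover have "g \<in> top_homotopy_class X x g" "h \<in> top_homotopy_class X x h"
    using assms by (auto simp: mem_top_homotopy_class path_homotopic_refl mem_top_loops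
       )
  ultimately show ?thesis unfolding top_pi1_def monoid.simps by blast
qed

lemma carrier_top_pi1: "carrier (top_pi1 X x) = top_homotopy_class X x ` top_loops X x"
  by (simp add: top_pi1_def)

lemma one_top_pi1: "\<one>\<^bsub>top_pi1 X x\<^esub> = top_homotopy_class X x (\<lambda>_. x)"
  by (simp add: top_pi1_def)

lemma join_top_loops:
  "g \<in> top_loops X x \<Longrightarrow> h \<in> top_loops X x \<Longrightarrow> top_join g h \<in> top_loops X x"
  unfolding mem_top_loops by (rule path_from_to_join)

lemma const_top_loops: "x \<in> topspace X \<Longrightarrow> (\<lambda>_. x) \<in> top_loops X x"
  by (simp add: top_loops_def)

lemma group_top_pi1:
  assumes "x \<in> topspace X"
  shows "group (top_pi1 X x)"
proof (rule groupI)
  show "u \<otimes>\<^bsub>top_pi1 X x\<^esub> v \<in> carrier (top_pi1 X x)"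
    if "u \<in> carrier (top_pi1 X x)" "v \<in> carrier (top_pi1 X x)" for u v
    using that by (auto simp: carrier_top_pi1 top_pi1_mult join_top_loops)
  show "\<one>\<^bsub>top_pi1 X x\<^esub> \<in> carrier (top_pi1 X x)"
    using assms by (simp add: carrier_top_pi1 one_top_pi1 const_top_loops)
  show "u \<otimes>\<^bsub>top_pi1 X x\<^esub> v \<otimes>\<^bsub>top_pi1 X x\<^esub> w = u \<otimes>\<^bsub>top_pi1 X x\<^esub> (v \<otimes>\<^bsub>top_pi1 X x\<^esub> w)"
    if "u \<in> carrier (top_pi1 X x)" "v \<in> carrier (top_pi1 X x)" "w \<in> carrier (top_pi1 X x)" for u v w
  proof -
    obtain f g h where "u = top_homotopy_class X x f" "v = top_homotopy_class X x g"
        "w = top_homotopy_class X x h"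
      and l: "f \<in> top_loops X x" "g \<in> top_loops X x" "h \<in> top_loops X x"
      using \<open>u \<in> _\<close> \<open>v \<in> _\<close> \<open>w \<in> _\<close> by (auto simp: carrier_top_pi1)
    moreover have "path_homotopic X x x (top_join (top_join h g) f) (top_join h (top_join g f))"
      using l by (auto simp: mem_top_loops intro: path_homotopic_assoc)
    ultimately show ?thesis
      by (simp add: top_pi1_mult join_top_loops top_homotopy_class_eq path_homotopic_sym)
  qed
  show "\<one>\<^bsub>top_pi1 X x\<^esub> \<otimes>\<^bsub>top_pi1 X x\<^esub> u = u" if "u \<in> carrier (top_pi1 X x)" for u
  proof -
    obtain g where g: "u = top_homotopy_class X x g" "g \<in> top_loops X x"
      using \<open>u \<in> _\<close> by (auto simp: carrier_top_pi1)
    \<comment> \<open>Products are written against the order of traversal, so the left unit comes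
      last in the path.\<close>
    then have "path_homotopic X x x (top_join g (\<lambda>_. x)) g"
      by (simp add: mem_top_loops path_homotopic_const_right)
    then show ?thesis
      using g assms
      by (simp add: one_top_pi1 top_pi1_mult const_top_loops join_top_loops top_homotopy_class_eq)
  qed
  show "\<exists>v\<in>carrier (top_pi1 X x). v \<otimes>\<^bsub>top_pi1 X x\<^esub> u = \<one>\<^bsub>top_pi1 X x\<^esub>"
    if u: "u \<in> carrier (top_pi1 X x)" for u
  proof -
    obtain g where g: "u = top_homotopy_class X x g" "g \<in> top_loops X x"
      using u by (auto simp: carrier_top_pi1)
    let ?h = "g \<circ> linear_path 1 0"
    have h: "?h \<in> top_loops X x" "path_homotopic X x x (top_join g ?h) (\<lambda>_. x)"
      using g by (auto simp: mem_top_loops intro: path_from_to_reverse path_homotopic_inverse_right)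
    then have "top_homotopy_class X x ?h \<otimes>\<^bsub>top_pi1 X x\<^esub> u = \<one>\<^bsub>top_pi1 X x\<^esub>"
      by (simp add: g top_pi1_mult one_top_pi1 top_homotopy_class_eq join_top_loops)
    then show ?thesis using h(1) by (auto simp: carrier_top_pi1)
  qed
qed

text \<open>The reverse of \<open>h\<close>, followed by \<open>h\<close>, is inserted after
  \<open>g\<close>; the loop formed by \<open>g\<close> and the reverse is null-homotopic, and
  \<open>h\<close> remains.\<close>

lemma simply_connected_space_homotopic:
  assumes "simply_connected_space X" "path_from_to X x y g" "path_from_to X x y h"
  shows "path_homotopic X x y g h"
proof -
  let ?k = "h \<circ> linear_path 1 0"
  have k: "path_from_to X y x ?k" using assms(3) by (rule path_from_to_reverse)
  then have gk: "path_from_to X x x (top_join g ?k)" using assms(2) path_from_to_join by metis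
  have "x \<in> topspace X" using assms(2) path_start_in_topspace by (auto simp: path_from_to_def)
  then have "top_homotopy_class X x (top_join g ?k) = top_homotopy_class X x (\<lambda>_. x)"
    using assms(1) gk
    unfolding simply_connected_space_def trivial_group_def carrier_top_pi1 one_top_pi1
      mem_top_loops[symmetric] by blast
  then have null: "path_homotopic X x x (top_join g ?k) (\<lambda>_. x)"
    using gk by (simp add: top_homotopy_class_eq mem_top_loops)
  have "path_homotopic X x y g (top_join g (\<lambda>_. y))"
    using path_homotopic_const_right[OF assms(2)] by (rule path_homotopic_sym)
  also have "path_homotopic X x y \<dots> (top_join g (top_join ?k h))"
    using path_homotopic_inverse_left[OF assms(3)] assms(2)
    by (intro path_homotopic_join) (auto simp: path_homotopic_refl intro: path_homotopic_sym)
  also have "path_homotopic X x y \<dots> (top_join (top_join g ?k) h)"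
    using path_homotopic_assoc[OF assms(2) k assms(3)] by (rule path_homotopic_sym)
  also have "path_homotopic X x y \<dots> (top_join (\<lambda>_. x) h)"
    using assms(3) null
    by (intro path_homotopic_join) (simp_all add: path_homotopic_refl)
  also have "path_homotopic X x y \<dots> h"
    using assms(3) by (rule path_homotopic_const_left)
  finally show ?thesis .
qed

section \<open>Curves covered by poset paths\<close>

definition edge_covers :: "(real \<Rightarrow> 'x) \<Rightarrow> real \<Rightarrow> 'x set simplex1 \<Rightarrow> real \<Rightarrow> bool" where
  "edge_covers g s b t \<longleftrightarrow> s < t \<and> g ` {s..t} \<subseteq> supp b \<and> g s \<in> bd1 b \<and> g t \<in> bd0 b"

text \<open>The recursive form of \<open>approximates\<close> on a parameter interval with free
  ends, fit for cutting and induction. The empty list covers nothing, in accordance with the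
  nonemptiness of paths.\<close>

primrec covers :: "(real \<Rightarrow> 'x) \<Rightarrow> real \<Rightarrow> 'x set simplex1 list \<Rightarrow> real \<Rightarrow> bool" where
  "covers g s [] t \<longleftrightarrow> False"
| "covers g s (b # q) t \<longleftrightarrow>
     (if q = [] then edge_covers g s b t else \<exists>r. covers g s q r \<and> edge_covers g r b t)"

text \<open>The subdivision is counted along the curve and the list against it, hence
  \<open>rev\<close>.\<close>

lemma covers_subdivision:
  assumes "q \<noteq> []"
  shows "covers g a q t \<longleftrightarrow>
    (\<exists>s :: nat \<Rightarrow> real. s 0 = a \<and> s (length q) = t \<and>
       (\<forall>i < length q. edge_covers g (s i) (rev q ! i) (s (Suc i))))"
  using assms
proof (induction q arbitrary: t)
  case Nil
  then show ?case by simp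
next
  case (Cons b q)
  show ?case
  proof (cases "q = []")
    case True
    have "\<exists>s :: nat \<Rightarrow> real. s 0 = a \<and> s (Suc 0) = t \<and> edge_covers g (s 0) b (s (Suc 0))"
      if "edge_covers g a b t"
      using that by (intro exI[of _ "\<lambda>i. if i = 0 then a else t"]) simp
    then show ?thesis using True by auto
  next
    case False
    note IH = Cons.IH[OF False]
    show ?thesis
    proof
      assume "covers g a (b # q) t"
      then obtain r s where s: "s 0 = a" "s (length q) = r"
        "\<And>i. i < length q \<Longrightarrow> edge_covers g (s i) (rev q ! i) (s (Suc i))" and "edge_covers g r b t"
        using False IH by auto
      then show "\<exists>s. s 0 = a \<and> s (length (b # q)) = t \<and>
          (\<forall>i < length (b # q). edge_covers g (s i) (rev (b # q) ! i) (s (Suc i)))"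
        using False by (intro exI[of _ "s(Suc (length q) := t)"]) (auto simp: nth_append less_Suc_eq)
    next
      assume "\<exists>s. s 0 = a \<and> s (length (b # q)) = t \<and>
          (\<forall>i < length (b # q). edge_covers g (s i) (rev (b # q) ! i) (s (Suc i)))"
      then obtain s where s: "s 0 = a" "s (Suc (length q)) = t"
          "\<And>i. i \<le> length q \<Longrightarrow> edge_covers g (s i) ((rev q @ [b]) ! i) (s (Suc i))"
        by (auto simp: less_Suc_eq_le)
      have "edge_covers g (s i) (rev q ! i) (s (Suc i))" if "i < length q" for i
        using s(3)[of i] that by (simp add: nth_append)
      then have "covers g a q (s (length q))" using IH s(1) by blast
      moreover have "edge_covers g (s (length q)) b t" using s(2) s(3)[of "length q"] by (simp add: nth_append)
      ultimately show "covers g a (b # q) t" using False by auto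
    qed
  qed
qed

lemma approximates_iff_covers: "q \<noteq> [] \<Longrightarrow> approximates q g \<longleftrightarrow> covers g 0 q 1"
  unfolding approximates_def covers_subdivision edge_covers_def by simp

lemma covers_append:
  assumes "p \<noteq> []" "q \<noteq> []"
  shows "covers g s (q @ p) t \<longleftrightarrow> (\<exists>r. covers g s p r \<and> covers g r q t)"
  using assms(2)
proof (induction q arbitrary: t)
  case (Cons b q)
  then show ?case using assms(1) by (cases "q = []") auto
qed simp

lemma covers_nonempty: "covers g s q t \<Longrightarrow> q \<noteq> []"
  by auto

lemma covers_less: "covers g s q t \<Longrightarrow> s < t"
  by (induction q arbitrary: t) (fastforce simp: edge_covers_def split: if_splits)+

lemma covers_start: "covers g s q t \<Longrightarrow> g s \<in> bd1 (last q)"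
  by (induction q arbitrary: t) (auto simp: edge_covers_def split: if_splits)

lemma covers_end: "covers g s q t \<Longrightarrow> g t \<in> bd0 (hd q)"
  by (cases q) (auto simp: edge_covers_def split: if_splits)

lemma edge_covers_affine:
  assumes "edge_covers g s b t" "c > 0" "\<And>u. u \<in> {s..t} \<Longrightarrow> h (c * u + d) = g u"
  shows "edge_covers h (c * s + d) b (c * t + d)"
proof -
  have "h v \<in> supp b" if "v \<in> {c * s + d..c * t + d}" for v
  proof -
    have "(v - d) / c \<in> {s..t}" "v = c * ((v - d) / c) + d"
      using that \<open>c > 0\<close> by (auto simp: field_simps)
    then show ?thesis using assms(1,3) by (metis edge_covers_def image_subset_iff)
  qed
  then show ?thesis using assms by (auto simp: edge_covers_def)
qed

text \<open>Used to rescale the two halves in \<open>covers_join\<close> and, with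
  \<open>c = 1\<close> and \<open>d = 0\<close>, to pass to a curve that agrees on the
  interval.\<close>

lemma covers_affine:
  assumes "covers g s q t" "c > 0" "\<And>u. u \<in> {s..t} \<Longrightarrow> h (c * u + d) = g u"
  shows "covers h (c * s + d) q (c * t + d)"
  using assms(1,3)
proof (induction q arbitrary: t)
  case (Cons b q)
  show ?case
  proof (cases "q = []")
    case False
    then obtain r where r: "covers g s q r" "edge_covers g r b t" using Cons.prems by auto
    then have "s < r" "r < t" using covers_less by (auto simp: edge_covers_def)
    then have "covers h (c * s + d) q (c * r + d)" "edge_covers h (c * r + d) b (c * t + d)"
      using r Cons by (auto intro!: edge_covers_affine[OF _ assms(2)])
    then show ?thesis using False by auto
  next
    case True
    then show ?thesis
      using Cons.prems edge_covers_affine[OF _ assms(2), of g s b t h d] by auto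
  qed
qed simp

lemma covers_join:
  assumes "covers g 0 p 1" "covers h 0 q 1" "g 1 = h 0"
  shows "covers (top_join g h) 0 (q @ p) 1"
proof -
  have "covers (top_join g h) (1/2 * 0 + 0) p (1/2 * 1 + 0)"
    by (rule covers_affine[OF assms(1)]) (auto simp: top_join_def)
  moreover have "covers (top_join g h) (1/2 * 0 + 1/2) q (1/2 * 1 + 1/2)"
    by (rule covers_affine[OF assms(2)]) (auto simp: top_join_def assms(3) field_simps)
  ultimately show ?thesis
    using covers_nonempty[OF assms(1)] covers_nonempty[OF assms(2)] by (auto simp: covers_append)
qed

lemma pathin_openin:
  assumes "pathin X g" "openin X S" "u \<in> {0..1}" "g u \<in> S"
  obtains \<delta> where "\<delta> > 0" "\<And>v. v \<in> {0..1} \<Longrightarrow> \<bar>v - u\<bar> < \<delta> \<Longrightarrow> g v \<in> S"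
proof -
  have "openin unit_interval {x \<in> topspace unit_interval. g x \<in> S}"
    using assms by (intro openin_continuous_map_preimage) (auto simp: pathin_def)
  then show ?thesis
    using assms that unfolding openin_euclidean_subtopology_iff by (auto simp: dist_real_def)
qed

lemma linear_path_mem: "s \<le> t \<Longrightarrow> u \<in> {0..1} \<Longrightarrow> linear_path s t u \<in> {s..t}"
  using convexD_alt[of "{s..t}" s t u] by (simp add: linear_path_def algebra_simps)

lemma path_from_to_subpath:
  assumes "pathin X g" "s \<in> {0..1}" "t \<in> {0..1}" "s \<le> t" "g ` {s..t} \<subseteq> S"
  shows "path_from_to (subtopology X S) (g s) (g t) (g \<circ> linear_path s t)"
  using pathin_compose_interval[OF assms(1) path_from_to_linear_path[OF assms(2,3)]]
    linear_path_mem[OF assms(4)] assms(5)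
  by (auto simp: path_from_to_def pathin_subtopology)

lemma path_homotopic_map:
  assumes "path_homotopic X x y g h" "continuous_map X Y f"
  shows "path_homotopic Y (f x) (f y) (f \<circ> g) (f \<circ> h)"
  using assms unfolding path_homotopic_def
  by (elim homotopic_with_compose_continuous_map_left) auto

lemma path_homotopic_subtopology:
  "path_homotopic (subtopology X S) x y g h \<Longrightarrow> path_homotopic X x y g h"
  using path_homotopic_map[of "subtopology X S" x y g h X id] continuous_map_id_subt by simp

text \<open>The stretch covered by \<open>m\<close> can be any subinterval, so the last premise
  quantifies over its ends.\<close>

lemma covers_replace:
  assumes "covers g s (r @ m @ p) t" "m \<noteq> []" "m' \<noteq> []"
    and "\<And>u v. covers g u m v \<Longrightarrow> covers g u m' v"
  shows "covers g s (r @ m' @ p) t"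
  using assms by (cases "r = []"; cases "p = []") (fastforce simp: covers_append)+

lemma poset_path_from_to_replace:
  assumes "poset_path_from_to P U V (r @ m @ p)" "m \<noteq> []" "m' \<noteq> []"
    and "\<And>x y. poset_path_from_to P x y m \<Longrightarrow> poset_path_from_to P x y m'"
  shows "poset_path_from_to P U V (r @ m' @ p)"
  using assms by (cases "r = []"; cases "p = []") (fastforce simp: poset_path_from_to_append)+

lemma path_from_to_subtopology:
  "path_from_to (subtopology X S) x y g \<longleftrightarrow> path_from_to X x y g \<and> g ` {0..1} \<subseteq> S"
  by (auto simp: path_from_to_def pathin_subtopology)

section \<open>Existence and uniqueness of covering paths\<close>

locale simply_connected_base =
  fixes X :: "'x topology" and C :: "'x set set"
  assumes C_openin: "V \<in> C \<Longrightarrow> openin X V"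
    and C_nonempty: "V \<in> C \<Longrightarrow> V \<noteq> {}"
    and C_base: "openin X W \<Longrightarrow> x \<in> W \<Longrightarrow> \<exists>V \<in> C. x \<in> V \<and> V \<subseteq> W"
    and C_simply_connected: "V \<in> C \<Longrightarrow> simply_connected_space (subtopology X V)"
begin

abbreviation C_order :: "'x set rel" where
  "C_order \<equiv> inclusion_order C"

sublocale preordering C_order
  by (rule preordering_inclusion_order)

text \<open>An intersection of members need not be a member; what is available is a smaller member
  around a given point.\<close>

lemma C_inter:
  assumes "V \<in> C" "W \<in> C" "x \<in> V" "x \<in> W"
  obtains Y where "Y \<in> C" "x \<in> Y" "Y \<subseteq> V" "Y \<subseteq> W"
  using C_base[OF openin_Int[OF C_openin C_openin], of V W x] assms by auto

text \<open>Compactness of the interval in the form of \<open>Bolzano\<close>: covering paths exist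
  on short intervals and are joined at a member around the intermediate point. The bound
  \<open>W\<close> serves \<open>parallel_edges_homotopic\<close>, where it is the intersection of
  two supports.\<close>

lemma exists_covering_path_within:
  assumes g: "pathin X g" and "openin X W" and st: "0 \<le> s" "s < t" "t \<le> 1"
    and "g ` {s..t} \<subseteq> W" and "V \<in> C" "V \<subseteq> W" "g s \<in> V" "V' \<in> C" "V' \<subseteq> W" "g t \<in> V'"
  shows "\<exists>q. poset_path_from_to C_order V V' q \<and> covers g s q t \<and> (\<forall>b \<in> set q. supp b \<subseteq> W)"
proof -
  \<comment> \<open>The conditions on \<open>u\<close> and \<open>v\<close> are part of
    \<open>P\<close> because the local step must also treat one-point intervals and intervals that
    leave [s, t].\<close>
  define P where "P u v \<longleftrightarrow> (s \<le> u \<and> u < v \<and> v \<le> t \<longrightarrow> (\<forall>V V'. V \<in> C \<longrightarrow> V \<subseteq> W \<longrightarrow> g u \<in> V \<longrightarrow>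
      V' \<in> C \<longrightarrow> V' \<subseteq> W \<longrightarrow> g v \<in> V' \<longrightarrow>
      (\<exists>q. poset_path_from_to C_order V V' q \<and> covers g u q v \<and> (\<forall>b \<in> set q. supp b \<subseteq> W))))" for u v
  have "s \<le> t" using st by simp
  then have "P s t"
  proof (induction rule: Bolzano)
    case (trans a b c)
    show ?case
    proof (cases "a < b \<and> b < c \<and> s \<le> a \<and> c \<le> t")
      case False
      then have "a = b \<or> b = c \<or> \<not> (s \<le> a \<and> c \<le> t)" using trans by auto
      then show ?thesis using trans by (auto simp: P_def)
    next
      case True
      then have "g b \<in> W" using assms by (auto simp: image_subset_iff)
      then obtain Y where Y: "Y \<in> C" "Y \<subseteq> W" "g b \<in> Y" using C_base assms(2) by blast
      show ?thesis
        unfolding P_def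
      proof (intro impI allI)
        fix V V' assume V: "V \<in> C" "V \<subseteq> W" "g a \<in> V" "V' \<in> C" "V' \<subseteq> W" "g c \<in> V'"
        obtain q where q: "poset_path_from_to C_order V Y q" "covers g a q b" "\<forall>b \<in> set q. supp b \<subseteq> W"
          using trans(1)[unfolded P_def, rule_format, of V Y] True V Y by auto
        obtain r where r: "poset_path_from_to C_order Y V' r" "covers g b r c" "\<forall>b \<in> set r. supp b \<subseteq> W"
          using trans(2)[unfolded P_def, rule_format, of Y V'] True V Y by auto
        show "\<exists>q. poset_path_from_to C_order V V' q \<and> covers g a q c \<and> (\<forall>b \<in> set q. supp b \<subseteq> W)"
          using q r covers_nonempty[OF q(2)] covers_nonempty[OF r(2)]
          by (intro exI[of _ "r @ q"]) (auto simp: covers_append intro: poset_path_from_to_appendI)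
      qed
    qed
  next
    case (local x)
    then have "g x \<in> W" and x: "x \<in> {0..1}" using assms by (auto simp: image_subset_iff)
    then obtain S where S: "S \<in> C" "S \<subseteq> W" "g x \<in> S" using C_base assms(2) by blast
    then obtain \<delta> where \<delta>: "\<delta> > 0" "\<And>v. v \<in> {0..1} \<Longrightarrow> \<bar>v - x\<bar> < \<delta> \<Longrightarrow> g v \<in> S"
      using pathin_openin[OF g C_openin x] by blast
    have "P a b" if ab: "a \<le> x \<and> x \<le> b \<and> b - a < \<delta>" for a b
      unfolding P_def
    proof (intro impI allI)
      fix V V' assume ab': "s \<le> a \<and> a < b \<and> b \<le> t"
        and V: "V \<in> C" "V \<subseteq> W" "g a \<in> V" "V' \<in> C" "V' \<subseteq> W" "g b \<in> V'"
      have I: "a \<in> {0..1}" "b \<in> {0..1}" using ab' st by auto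
      obtain d where d: "d > 0" "\<And>v. v \<in> {0..1} \<Longrightarrow> \<bar>v - a\<bar> < d \<Longrightarrow> g v \<in> V"
        using pathin_openin[OF g C_openin[OF V(1)] I(1) V(3)] by blast
      obtain e where e: "e > 0" "\<And>v. v \<in> {0..1} \<Longrightarrow> \<bar>v - b\<bar> < e \<Longrightarrow> g v \<in> V'"
        using pathin_openin[OF g C_openin[OF V(4)] I(2) V(6)] by blast
      \<comment> \<open>Near \<open>a\<close> the curve stays in \<open>V\<close>, near
        \<open>b\<close> in \<open>V'\<close>. Half of each radius keeps the bounds strict, and a
        third of the length keeps \<open>a' < b'\<close>.\<close>
      define a' where "a' = a + min (d / 2) ((b - a) / 3)"
      define b' where "b' = b - min (e / 2) ((b - a) / 3)"
      have a': "a < a'" "a' - a < d" "3 * (a' - a) \<le> b - a" and b': "b' < b" "b - b' < e" "3 * (b - b') \<le> b - a"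
        using d(1) e(1) ab' by (auto simp: a'_def b'_def min_def)
      have lt: "a' < b'" using a'(3) b'(3) ab' by argo
      have gS: "g v \<in> S" if "v \<in> {a..b}" for v
        using that ab I by (intro \<delta>(2)) auto
      have gV: "g v \<in> V" if "v \<in> {a..a'}" for v
        using that a' b' lt I by (intro d(2)) auto
      have gV': "g v \<in> V'" if "v \<in> {b'..b}" for v
        using that a' b' lt I by (intro e(2)) auto
      obtain Y1 where Y1: "Y1 \<in> C" "g a' \<in> Y1" "Y1 \<subseteq> V" "Y1 \<subseteq> S"
        using C_inter[OF V(1) S(1), of "g a'"] gV[of a'] gS[of a'] a' b' lt by auto
      obtain Y2 where Y2: "Y2 \<in> C" "g b' \<in> Y2" "Y2 \<subseteq> V'" "Y2 \<subseteq> S"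
        using C_inter[OF V(4) S(1), of "g b'"] gV'[of b'] gS[of b'] a' b' lt by auto
      \<comment> \<open>\<open>V\<close> and \<open>V'\<close> need not lie in \<open>S\<close>, so
        two outer edges with supports \<open>V\<close> and \<open>V'\<close> connect them with
        smaller vertices inside \<open>S\<close>.\<close>
      let ?q = "[Simplex1 V' V' Y2, Simplex1 S Y2 Y1, Simplex1 V Y1 V]"
      have "poset_path_from_to C_order V V' ?q"
        using V S Y1 Y2 by (simp add: poset_path_from_to_Cons mem_inclusion_order)
      moreover have "edge_covers g a (Simplex1 V Y1 V) a'" "edge_covers g a' (Simplex1 S Y2 Y1) b'"
          "edge_covers g b' (Simplex1 V' V' Y2) b"
        using a' b' lt gV gV' gS Y1 Y2 V by (auto simp: edge_covers_def)
      then have "covers g a ?q b" by auto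
      ultimately show "\<exists>q. poset_path_from_to C_order V V' q \<and> covers g a q b \<and> (\<forall>b \<in> set q. supp b \<subseteq> W)"
        using V S by (intro exI[of _ ?q]) auto
    qed
    then show ?case using \<delta>(1) by blast
  qed
  then show ?thesis using assms unfolding P_def by simp
qed

lemma exists_covering_path:
  assumes "pathin X g" "0 \<le> s" "s < t" "t \<le> 1" "V \<in> C" "g s \<in> V" "V' \<in> C" "g t \<in> V'"
  shows "\<exists>q. poset_path_from_to C_order V V' q \<and> covers g s q t"
  using exists_covering_path_within[of g "topspace X" s t V V'] assms
    path_image_subset_topspace[OF assms(1)] C_openin openin_subset
  by (fastforce simp: image_subset_iff)

text \<open>\<open>S\<close> and \<open>S'\<close> need not have a common upper bound in
  \<open>C\<close>. Instead, a path that covers the same piece of the curve with supports inside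
  \<open>S \<inter> S'\<close> contracts to either edge.\<close>

lemma parallel_edges_homotopic:
  assumes g: "pathin X g" and "0 \<le> s" "t \<le> 1"
    and edge: "edge_covers g s (Simplex1 S V Y) t" "edge_covers g s (Simplex1 S' V Y) t"
    and C: "is_simplex1 C_order (Simplex1 S V Y)" "is_simplex1 C_order (Simplex1 S' V Y)"
  shows "poset_homotopic C_order [Simplex1 S V Y] [Simplex1 S' V Y]"
proof -
  have in_C: "S \<in> C" "S' \<in> C" "V \<in> C" "Y \<in> C" "Y \<subseteq> S" "Y \<subseteq> S'" "V \<subseteq> S" "V \<subseteq> S'"
    using C by (auto simp: mem_inclusion_order)
  have "\<exists>q. poset_path_from_to C_order Y V q \<and> covers g s q t \<and> (\<forall>b \<in> set q. supp b \<subseteq> S \<inter> S')"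
    using edge assms(2,3) in_C
    by (intro exists_covering_path_within[OF g] openin_Int C_openin) (auto simp: edge_covers_def)
  then obtain q where q: "poset_path_from_to C_order Y V q" "\<And>b. b \<in> set q \<Longrightarrow> supp b \<subseteq> S \<inter> S'"
    by blast
  have "supp b \<in> C" if "b \<in> set q" for b
    using q(1) that by (auto simp: poset_path_from_to_def poset_path_def is_simplex1_def mem_inclusion_order)
  then have "poset_homotopic C_order q [Simplex1 S V Y]" "poset_homotopic C_order q [Simplex1 S' V Y]"
    using q in_C by (auto intro!: contract_path simp: mem_inclusion_order)
  then show ?thesis by (meson equivclp_sym equivclp_trans)
qed

text \<open>Two paths cut at the same time can be given a common end this way. The number of edges
  stays the same, as the induction in \<open>covering_paths_homotopic\<close> requires; the price is
  one edge with support \<open>V\<close> from \<open>Y\<close> back to \<open>V\<close>.\<close>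

lemma shrink_end:
  assumes "poset_path_from_to C_order U V q" "covers g s q t" "Y \<in> C" "Y \<subseteq> V" "g t \<in> Y"
  obtains p where "poset_path_from_to C_order U Y p" "covers g s p t" "length p = length q"
    "poset_homotopic C_order q (Simplex1 V V Y # p)"
proof -
  obtain b r where q: "q = b # r" using assms(2) by (cases q) auto
  let ?b = "Simplex1 (supp b) Y (bd1 b)"
  have b: "bd0 b = V" "V \<in> C" "V \<subseteq> supp b" "supp b \<in> C" "bd1 b \<in> C" "bd1 b \<subseteq> supp b"
    using assms(1) unfolding q
    by (auto simp: poset_path_from_to_Cons is_simplex1_def mem_inclusion_order)
  have ft: "poset_path_from_to C_order U Y (?b # r)"
    using assms b unfolding q by (auto simp: poset_path_from_to_Cons mem_inclusion_order)
  have "edge_covers g u ?b t" if "edge_covers g u b t" for u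
    using that assms by (auto simp: edge_covers_def)
  then have cov: "covers g s (?b # r) t" using assms(2) unfolding q by (auto split: if_splits)
  have edge: "poset_homotopic C_order [b] [Simplex1 V V Y, ?b]"
    by (rule homotopic_if_common_bound[where x = "bd1 b" and y = V and S = "supp b"])
      (use b assms in \<open>auto simp: poset_path_from_to_Cons mem_inclusion_order is_simplex1_def\<close>)
  have "poset_homotopic C_order q (Simplex1 V V Y # ?b # r)"
  proof (cases "r = []")
    case False
    then have "poset_path_from_to C_order U (bd1 b) r" "poset_path_from_to C_order (bd1 b) V [b]"
      using assms(1) b unfolding q by (auto simp: poset_path_from_to_Cons split: if_splits)
    from poset_homotopic_append[OF equivclp_refl edge this] show ?thesis by (simp add: q)
  qed (use edge q in simp)
  with ft cov show ?thesis using that by (simp add: q)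
qed

text \<open>The path \<open>b # r\<close> is cut at a time \<open>t1\<close> covered by its last edge \<open>b\<close>. When \<open>t1\<close> is the time at
  which \<open>b\<close> starts, the cut shortens the path.\<close>
lemma cut_path:
  assumes ft: "poset_path_from_to C_order U V (b # r)" and edge: "edge_covers g t0 b t"
    and r: "if r = [] then t0 = s else covers g s r t0" and t1: "s < t1" "t0 \<le> t1" "t1 < t"
  shows "\<exists>W \<in> C. g t1 \<in> W \<and> W \<subseteq> supp b \<and>
    (\<forall>Y \<in> C. g t1 \<in> Y \<longrightarrow> Y \<subseteq> W \<longrightarrow>
      (\<exists>p. poset_path_from_to C_order U Y p \<and> covers g s p t1 \<and>
         length p \<le> length (b # r) \<and> (t1 = t0 \<longrightarrow> length p < length (b # r)) \<and>
         poset_homotopic C_order (b # r) (Simplex1 (supp b) V Y # p)))"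
  (is "\<exists>W \<in> C. _ \<and> _ \<and> (\<forall>Y \<in> C. _ \<longrightarrow> _ \<longrightarrow> ?cut Y)")
proof -
  have b: "bd0 b = V" "V \<in> C" "V \<subseteq> supp b" "supp b \<in> C" "bd1 b \<in> C" "bd1 b \<subseteq> supp b"
    using ft by (auto simp: poset_path_from_to_Cons is_simplex1_def mem_inclusion_order)
  have fb: "poset_path_from_to C_order (bd1 b) V [b]"
    using b by (simp add: poset_path_from_to_Cons is_simplex1_def mem_inclusion_order)
  show ?thesis
  proof (cases "t1 = t0")
    case True
    then have ne: "r \<noteq> []" and cov: "covers g s r t0" using r t1 by (auto split: if_splits)
    then have fr: "poset_path_from_to C_order U (bd1 b) r"
      using ft by (simp add: poset_path_from_to_Cons)
    have "?cut Y"
      if Y: "Y \<in> C" "g t1 \<in> Y" "Y \<subseteq> bd1 b" for Y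
    proof -
      obtain p where p: "poset_path_from_to C_order U Y p" "covers g s p t0" "length p = length r"
          "poset_homotopic C_order r (Simplex1 (bd1 b) (bd1 b) Y # p)"
        using shrink_end[OF fr cov Y(1,3)] Y True by blast
      have "poset_homotopic C_order ([b] @ r) ([b] @ Simplex1 (bd1 b) (bd1 b) Y # p)"
        by (rule poset_homotopic_append[OF p(4) equivclp_refl fr fb])
      \<comment> \<open>\<open>b\<close> and the edge left over by \<open>shrink_end\<close> fuse
        into a single edge with support \<open>supp b\<close>.\<close>
      also have "[b] @ Simplex1 (bd1 b) (bd1 b) Y # p = [b, Simplex1 (bd1 b) (bd1 b) Y] @ p" by simp
      also have "poset_homotopic C_order \<dots> ([Simplex1 (supp b) V Y] @ p)"
      proof (rule poset_homotopic_append[OF equivclp_refl _ p(1)])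
        show "poset_path_from_to C_order Y V [b, Simplex1 (bd1 b) (bd1 b) Y]"
          using b Y by (auto simp: poset_path_from_to_Cons is_simplex1_def mem_inclusion_order)
        then show "poset_homotopic C_order [b, Simplex1 (bd1 b) (bd1 b) Y] [Simplex1 (supp b) V Y]"
          using b by (intro contract_path) (auto simp: mem_inclusion_order)
      qed
      finally show ?thesis using p True by auto
    qed
    moreover have "g t1 \<in> bd1 b" using edge True by (simp add: edge_covers_def)
    ultimately show ?thesis using b by blast
  next
    case False
    have "?cut Y"
      if Y: "Y \<in> C" "g t1 \<in> Y" "Y \<subseteq> supp b" for Y
    proof -
      let ?b = "Simplex1 (supp b) Y (bd1 b)"
      have 1: "poset_path_from_to C_order U Y (?b # r)"
        using ft b Y by (auto simp: poset_path_from_to_Cons mem_inclusion_order)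
      have "edge_covers g t0 ?b t1"
        using edge Y t1 False by (auto simp: edge_covers_def)
      then have 2: "covers g s (?b # r) t1" using r by auto
      have 3: "poset_homotopic C_order [b] [Simplex1 (supp b) V Y, ?b]"
        by (rule homotopic_if_common_bound[where x = "bd1 b" and y = V and S = "supp b"])
          (use b Y in \<open>auto simp: poset_path_from_to_Cons mem_inclusion_order is_simplex1_def\<close>)
      have 4: "poset_homotopic C_order (b # r) (Simplex1 (supp b) V Y # ?b # r)"
      proof (cases "r = []")
        case False
        then have "poset_path_from_to C_order U (bd1 b) r"
          using ft by (simp add: poset_path_from_to_Cons)
        from poset_homotopic_append[OF equivclp_refl 3 this fb] show ?thesis by simp
      qed (use 3 in simp)
      show ?thesis by (intro exI[of _ "?b # r"]) (use 1 2 4 False in auto)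
    qed
    moreover have "g t1 \<in> supp b" using edge t1 by (auto simp: edge_covers_def)
    ultimately show ?thesis using b by blast
  qed
qed

lemma covers_Cons_cases:
  assumes "covers g s (b # r) t"
  obtains t0 where "edge_covers g t0 b t" "if r = [] then t0 = s else covers g s r t0" "s \<le> t0" "t0 < t"
  using assms covers_less[of g s r] that
  by (cases "r = []") (auto simp: edge_covers_def less_imp_le)

text \<open>The measure is the total number of edges. At \<open>t1\<close> one path loses an edge
  and the other gets no longer; a common smaller vertex \<open>Y\<close> makes the remaining paths
  comparable, and the pieces after \<open>t1\<close> are parallel edges.\<close>

lemma covering_paths_homotopic:
  assumes g: "pathin X g" and "0 \<le> s" "t \<le> 1"
    and "poset_path_from_to C_order U V q" "covers g s q t"
    and "poset_path_from_to C_order U V q'" "covers g s q' t"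
  shows "poset_homotopic C_order q q'"
  using assms(3-)
proof (induction "length q + length q'" arbitrary: q q' V t rule: less_induct)
  case less
  obtain b r where q: "q = b # r" using less.prems by (cases q) auto
  obtain b' r' where q': "q' = b' # r'" using less.prems by (cases q') auto
  obtain t0 where t0: "edge_covers g t0 b t" "if r = [] then t0 = s else covers g s r t0" "s \<le> t0" "t0 < t"
    using less.prems q covers_Cons_cases by metis
  obtain t0' where t0': "edge_covers g t0' b' t" "if r' = [] then t0' = s else covers g s r' t0'" "s \<le> t0'" "t0' < t"
    using less.prems q' covers_Cons_cases by metis
  define t1 where "t1 = max t0 t0'"
  have b: "is_simplex1 C_order b" "is_simplex1 C_order b'" "bd0 b = V" "bd0 b' = V"
    using less.prems by (auto simp: q q' poset_path_from_to_Cons)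
  show ?case
  proof (cases "s < t1")
    case False
    \<comment> \<open>Both final edges start at \<open>s\<close>, so neither path has another
      edge.\<close>
    then have "t0 = s" "t0' = s" using t0 t0' by (auto simp: t1_def)
    then have r: "r = []" "r' = []" using t0(2) t0'(2) covers_less by (force split: if_splits)+
    then have "bd1 b = U" "bd1 b' = U" using less.prems by (auto simp: q q' poset_path_from_to_Cons)
    then have eq: "b = Simplex1 (supp b) V U" "b' = Simplex1 (supp b') V U"
      using b by (metis simplex1.collapse)+
    have "poset_homotopic C_order [Simplex1 (supp b) V U] [Simplex1 (supp b') V U]"
      using parallel_edges_homotopic[OF g assms(2) less.prems(1), of "supp b" V U "supp b'"]
        t0(1) t0'(1) \<open>t0 = s\<close> \<open>t0' = s\<close> b(1,2) eq by simp
    then show ?thesis using eq by (simp add: q q' r)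
  next
    case True
    have t1: "t0 \<le> t1" "t0' \<le> t1" "t1 < t" "t1 = t0 \<or> t1 = t0'"
      using t0(4) t0'(4) by (auto simp: t1_def)
    obtain W where W: "W \<in> C" "g t1 \<in> W" "W \<subseteq> supp b"
      "\<And>Y. Y \<in> C \<Longrightarrow> g t1 \<in> Y \<Longrightarrow> Y \<subseteq> W \<Longrightarrow>
        \<exists>p. poset_path_from_to C_order U Y p \<and> covers g s p t1 \<and> length p \<le> length q \<and>
          (t1 = t0 \<longrightarrow> length p < length q) \<and> poset_homotopic C_order q (Simplex1 (supp b) V Y # p)"
      using cut_path[OF less.prems(2)[unfolded q] t0(1,2) True t1(1,3)] unfolding q by metis
    obtain W' where W': "W' \<in> C" "g t1 \<in> W'" "W' \<subseteq> supp b'"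
      "\<And>Y. Y \<in> C \<Longrightarrow> g t1 \<in> Y \<Longrightarrow> Y \<subseteq> W' \<Longrightarrow>
        \<exists>p. poset_path_from_to C_order U Y p \<and> covers g s p t1 \<and> length p \<le> length q' \<and>
          (t1 = t0' \<longrightarrow> length p < length q') \<and> poset_homotopic C_order q' (Simplex1 (supp b') V Y # p)"
      using cut_path[OF less.prems(4)[unfolded q'] t0'(1,2) True t1(2,3)] unfolding q' by metis
    obtain Y where Y: "Y \<in> C" "g t1 \<in> Y" "Y \<subseteq> W" "Y \<subseteq> W'"
      using C_inter[OF W(1) W'(1) W(2) W'(2)] by blast
    obtain p where p: "poset_path_from_to C_order U Y p" "covers g s p t1" "length p \<le> length q"
        "t1 = t0 \<longrightarrow> length p < length q" "poset_homotopic C_order q (Simplex1 (supp b) V Y # p)"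
      using W(4)[OF Y(1-3)] by blast
    obtain p' where p': "poset_path_from_to C_order U Y p'" "covers g s p' t1" "length p' \<le> length q'"
        "t1 = t0' \<longrightarrow> length p' < length q'" "poset_homotopic C_order q' (Simplex1 (supp b') V Y # p')"
      using W'(4)[OF Y(1,2,4)] by blast
    have "length p + length p' < length q + length q'"
      using p(3,4) p'(3,4) t1(4) by auto
    then have pp': "poset_homotopic C_order p p'"
      using less.hyps[OF _ _ p(1,2) p'(1,2)] t1(3) less.prems(1) by auto
    have e: "is_simplex1 C_order (Simplex1 (supp b) V Y)" "is_simplex1 C_order (Simplex1 (supp b') V Y)"
      using b Y W(3) W'(3) by (auto simp: is_simplex1_def mem_inclusion_order)
    have "poset_homotopic C_order [Simplex1 (supp b) V Y] [Simplex1 (supp b') V Y]"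
    proof (rule parallel_edges_homotopic[OF g _ less.prems(1) _ _ e])
      show "0 \<le> t1" using True assms(2) by simp
      show "edge_covers g t1 (Simplex1 (supp b) V Y) t" "edge_covers g t1 (Simplex1 (supp b') V Y) t"
        using t0(1) t0'(1) t1 Y b(3,4) by (auto simp: edge_covers_def)
    qed
    from poset_homotopic_append[OF pp' this p(1), of V]
    have "poset_homotopic C_order (Simplex1 (supp b) V Y # p) (Simplex1 (supp b') V Y # p')"
      using e(1) by (simp add: poset_path_from_to_single)
    with p(5) p'(5) show ?thesis by (meson equivclp_sym equivclp_trans)
  qed
qed

section \<open>Stability under homotopies of curves\<close>

lemma simplex_in_C:
  assumes "is_simplex1 C_order b"
  shows "supp b \<in> C" "bd0 b \<in> C" "bd1 b \<in> C" "bd0 b \<subseteq> supp b" "bd1 b \<subseteq> supp b"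
  using assms by (auto simp: is_simplex1_def mem_inclusion_order)

text \<open>The tube lemma for the compact segment over \<open>\<tau>\<close>. Segments with
  \<open>s = t\<close> express the conditions at the vertices.\<close>

lemma openin_slice:
  assumes H: "continuous_map (prod_topology unit_interval unit_interval) X H" and "V \<in> C"
    and "\<tau> \<in> {0..1}" "0 \<le> s" "t \<le> 1" "\<And>u. u \<in> {s..t} \<Longrightarrow> H (\<tau>, u) \<in> V"
  shows "\<exists>N. openin unit_interval N \<and> \<tau> \<in> N \<and> (\<forall>\<sigma>\<in>N. \<forall>u\<in>{s..t}. H (\<sigma>, u) \<in> V)"
proof -
  let ?Q = "prod_topology unit_interval unit_interval"
  have "openin ?Q {z \<in> topspace ?Q. H z \<in> V}"
    using H C_openin[OF assms(2)] by (rule openin_continuous_map_preimage)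
  moreover have "compactin unit_interval {s..t}"
    using assms by (auto simp: compactin_subtopology)
  moreover have "{\<tau>} \<times> {s..t} \<subseteq> {z \<in> topspace ?Q. H z \<in> V}"
    using assms by auto
  ultimately obtain N N' where "openin unit_interval N" "\<tau> \<in> N" "{s..t} \<subseteq> N'"
      "N \<times> N' \<subseteq> {z \<in> topspace ?Q. H z \<in> V}"
    using tube_lemma_right[of unit_interval unit_interval "{z \<in> topspace ?Q. H z \<in> V}" "{s..t}" \<tau>] assms(3)
    by auto
  then show ?thesis by (intro exI[of _ N]) blast
qed

text \<open>A fixed subdivision imposes finitely many conditions, each open by
  \<open>openin_slice\<close>; the neighbourhoods are intersected edge by edge.\<close>

lemma covers_stable:
  assumes H: "continuous_map (prod_topology unit_interval unit_interval) X H"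
    and \<tau>: "\<tau> \<in> {0..1}" and "poset_path_from_to C_order U V q"
    and "covers (\<lambda>u. H (\<tau>, u)) s q t" "0 \<le> s" "t \<le> 1"
  shows "\<exists>N. openin unit_interval N \<and> \<tau> \<in> N \<and> (\<forall>\<sigma>\<in>N. covers (\<lambda>u. H (\<sigma>, u)) s q t)"
proof -
  have edge: "\<exists>N. openin unit_interval N \<and> \<tau> \<in> N \<and> (\<forall>\<sigma>\<in>N. edge_covers (\<lambda>u. H (\<sigma>, u)) s b t)"
    if b: "is_simplex1 C_order b" and e: "edge_covers (\<lambda>u. H (\<tau>, u)) s b t" and st: "0 \<le> s" "t \<le> 1"
    for b s t
  proof -
    have "\<exists>N. openin unit_interval N \<and> \<tau> \<in> N \<and> (\<forall>\<sigma>\<in>N. \<forall>u\<in>{s..t}. H (\<sigma>, u) \<in> supp b)"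
      "\<exists>N. openin unit_interval N \<and> \<tau> \<in> N \<and> (\<forall>\<sigma>\<in>N. \<forall>u\<in>{s..s}. H (\<sigma>, u) \<in> bd1 b)"
      "\<exists>N. openin unit_interval N \<and> \<tau> \<in> N \<and> (\<forall>\<sigma>\<in>N. \<forall>u\<in>{t..t}. H (\<sigma>, u) \<in> bd0 b)"
      using e st simplex_in_C[OF b]
      by (intro openin_slice[OF H _ \<tau>]; force simp: edge_covers_def image_subset_iff)+
    then obtain N1 N2 N3 where "openin unit_interval N1" "\<tau> \<in> N1" "\<forall>\<sigma>\<in>N1. \<forall>u\<in>{s..t}. H (\<sigma>, u) \<in> supp b"
      "openin unit_interval N2" "\<tau> \<in> N2" "\<forall>\<sigma>\<in>N2. H (\<sigma>, s) \<in> bd1 b"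
      "openin unit_interval N3" "\<tau> \<in> N3" "\<forall>\<sigma>\<in>N3. H (\<sigma>, t) \<in> bd0 b"
      by auto
    then show ?thesis
      using e by (intro exI[of _ "N1 \<inter> N2 \<inter> N3"]) (auto simp: edge_covers_def intro!: openin_Int)
  qed
  show ?thesis
    using assms(3-)
  proof (induction arbitrary: t rule: poset_path_induct)
    case (single b)
    then show ?case using edge[of b s t] by simp
  next
    case (Cons b q)
    have q: "q \<noteq> []" using Cons.hyps(2) by (rule poset_path_from_to_nonempty)
    then obtain r where r: "covers (\<lambda>u. H (\<tau>, u)) s q r" "edge_covers (\<lambda>u. H (\<tau>, u)) r b t"
      using Cons.prems(1) by auto
    then have "s < r" "r < t" using covers_less by (auto simp: edge_covers_def)
    then obtain N1 N2 where "openin unit_interval N1" "\<tau> \<in> N1" "\<forall>\<sigma>\<in>N1. covers (\<lambda>u. H (\<sigma>, u)) s q r"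
      "openin unit_interval N2" "\<tau> \<in> N2" "\<forall>\<sigma>\<in>N2. edge_covers (\<lambda>u. H (\<sigma>, u)) r b t"
      using Cons.IH[OF r(1)] edge[OF Cons.hyps(1) r(2)] Cons.prems by auto
    then show ?case using q by (intro exI[of _ "N1 \<inter> N2"]) auto
  qed
qed

text \<open>A path covering one curve of the homotopy covers all nearby ones, so the class of the covering
  paths is locally constant along the homotopy.\<close>
lemma covering_paths_of_homotopic_curves:
  assumes "path_homotopic X x y g h" and UV: "U \<in> C" "V \<in> C" "x \<in> U" "y \<in> V"
    and q: "poset_path_from_to C_order U V q" "covers g 0 q 1"
    and q': "poset_path_from_to C_order U V q'" "covers h 0 q' 1"
  shows "poset_homotopic C_order q q'"
proof -
  obtain H where H: "continuous_map (prod_topology unit_interval unit_interval) X H"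
      "\<And>u. H (0, u) = g u" "\<And>u. H (1, u) = h u" "\<And>t. t \<in> {0..1} \<Longrightarrow> H (t, 0) = x \<and> H (t, 1) = y"
    using assms(1) unfolding path_homotopic_def homotopic_with_def by auto
  have path: "pathin X (\<lambda>u. H (\<tau>, u))" if "\<tau> \<in> {0..1}" for \<tau>
    using continuous_map_o_Pair[OF H(1), of \<tau>] that by (simp add: pathin_def comp_def)
  have ex: "\<exists>q. poset_path_from_to C_order U V q \<and> covers (\<lambda>u. H (\<tau>, u)) 0 q 1" if "\<tau> \<in> {0..1}" for \<tau>
    using exists_covering_path[OF path[OF that], of 0 1 U V] UV H(4)[OF that] by simp
  \<comment> \<open>The range is part of \<open>R\<close> because the local step also meets
    intervals that leave [0, 1].\<close>
  define R where "R u v \<longleftrightarrow> (0 \<le> u \<and> v \<le> 1 \<longrightarrow> (\<forall>q q'. poset_path_from_to C_order U V q \<longrightarrow>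
    covers (\<lambda>t. H (u, t)) 0 q 1 \<longrightarrow> poset_path_from_to C_order U V q' \<longrightarrow>
    covers (\<lambda>t. H (v, t)) 0 q' 1 \<longrightarrow> poset_homotopic C_order q q'))" for u v
  have "(0::real) \<le> 1" by simp
  then have "R 0 1"
  proof (induction rule: Bolzano)
    case (trans a b c)
    show ?case
      unfolding R_def
    proof (intro impI allI)
      fix q q' assume q: "0 \<le> a \<and> c \<le> 1" "poset_path_from_to C_order U V q" "covers (\<lambda>t. H (a, t)) 0 q 1"
        "poset_path_from_to C_order U V q'" "covers (\<lambda>t. H (c, t)) 0 q' 1"
      \<comment> \<open>Without a path covering the middle curve the two hypotheses could not be
        chained.\<close>
      obtain r where r: "poset_path_from_to C_order U V r" "covers (\<lambda>t. H (b, t)) 0 r 1"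
        using ex[of b] trans(3,4) q(1) by auto
      have "poset_homotopic C_order q r" "poset_homotopic C_order r q'"
        using trans(1)[unfolded R_def, rule_format, OF _ q(2,3) r] 
          trans(2)[unfolded R_def, rule_format, OF _ r q(4,5)] trans(3,4) q(1) by auto
      then show "poset_homotopic C_order q q'" by (rule equivclp_trans)
    qed
  next
    case (local \<tau>)
    then have \<tau>: "\<tau> \<in> {0..1}" by simp
    obtain r where r: "poset_path_from_to C_order U V r" "covers (\<lambda>t. H (\<tau>, t)) 0 r 1"
      using ex[OF \<tau>] by blast
    obtain N where N: "openin unit_interval N" "\<tau> \<in> N" "\<forall>\<sigma>\<in>N. covers (\<lambda>u. H (\<sigma>, u)) 0 r 1"
      using covers_stable[OF H(1) \<tau> r] by auto
    obtain d where d: "d > 0" "\<And>\<sigma>. \<sigma> \<in> {0..1} \<Longrightarrow> \<bar>\<sigma> - \<tau>\<bar> < d \<Longrightarrow> \<sigma> \<in> N"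
      using N(1,2) unfolding openin_euclidean_subtopology_iff by (auto simp: dist_real_def)
    have "R a b" if ab: "a \<le> \<tau> \<and> \<tau> \<le> b \<and> b - a < d" for a b
      unfolding R_def
    proof (intro impI allI)
      fix q q' assume q: "0 \<le> a \<and> b \<le> 1" "poset_path_from_to C_order U V q" "covers (\<lambda>t. H (a, t)) 0 q 1"
        "poset_path_from_to C_order U V q'" "covers (\<lambda>t. H (b, t)) 0 q' 1"
      have I: "a \<in> {0..1}" "b \<in> {0..1}" using ab q(1) by auto
      then have "a \<in> N" "b \<in> N" using ab by (auto intro!: d(2))
      then have r': "covers (\<lambda>t. H (a, t)) 0 r 1" "covers (\<lambda>t. H (b, t)) 0 r 1" using N(3) by auto
      have "poset_homotopic C_order q r" "poset_homotopic C_order r q'"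
        using covering_paths_homotopic[OF path[OF I(1)] _ _ q(2,3) r(1) r'(1)]
          covering_paths_homotopic[OF path[OF I(2)] _ _ r(1) r'(2) q(4,5)] by simp_all
      then show "poset_homotopic C_order q q'" by (rule equivclp_trans)
    qed
    then show ?case using d(1) by blast
  qed
  then show ?thesis using q q' unfolding R_def by (simp add: H(2,3))
qed

section \<open>From covering paths back to curves\<close>

lemma exists_path_in_C:
  assumes "V \<in> C" "x \<in> V" "y \<in> V"
  obtains \<gamma> where "path_from_to (subtopology X V) x y \<gamma>"
proof -
  have "path_connected_space (subtopology X V)"
    using C_simply_connected[OF assms(1)] by (simp add: simply_connected_space_def)
  moreover have "x \<in> topspace (subtopology X V)" "y \<in> topspace (subtopology X V)"
    using assms C_openin openin_subset by force+
  ultimately show ?thesis using that by (auto simp: path_connected_space_def path_from_to_def)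
qed

lemma path_homotopic_in_C:
  assumes "V \<in> C" "path_from_to (subtopology X V) x y g" "path_from_to (subtopology X V) x y h"
  shows "path_homotopic X x y g h"
  using simply_connected_space_homotopic[OF C_simply_connected assms(2,3)] assms(1)
  by (auto intro: path_homotopic_subtopology)

text \<open>A ladder of squares: the curves may pass a vertex at different times and points, so the
  induction carries a path \<open>\<gamma>\<close> inside that vertex as a rung. Each square lies in
  one support.\<close>

lemma curves_with_common_cover:
  assumes g: "pathin X g" and g': "pathin X g'" and "poset_path_from_to C_order U V q"
    and "covers g s q t" "covers g' s' q t'" "0 \<le> s" "0 \<le> s'" "t \<le> 1" "t' \<le> 1" "g s = g' s'"
    and "path_from_to (subtopology X V) (g t) (g' t') \<gamma>"
  shows "path_homotopic X (g s) (g' t') (top_join (g \<circ> linear_path s t) \<gamma>) (g' \<circ> linear_path s' t')"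
  using assms(3-)
proof (induction arbitrary: t t' \<gamma> rule: poset_path_induct)
  case (single b)
  let ?S = "subtopology X (supp b)"
  have e: "edge_covers g s b t" "edge_covers g' s' b t'" using single by auto
  have C: "supp b \<in> C" "bd0 b \<subseteq> supp b" using simplex_in_C[OF single.hyps(1)] by auto
  have 1: "path_from_to ?S (g s) (g t) (g \<circ> linear_path s t)"
      "path_from_to ?S (g' s') (g' t') (g' \<circ> linear_path s' t')"
    using single.prems e
    by (intro path_from_to_subpath g g'; simp add: edge_covers_def)+
  have "path_from_to ?S (g t) (g' t') \<gamma>"
    using single.prems(8) C(2) by (auto simp: path_from_to_subtopology)
  then show ?case
    using path_homotopic_in_C[OF C(1) path_from_to_join[OF 1(1)], of "g' t'" \<gamma> "g' \<circ> linear_path s' t'"]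
      1(2) single.prems(7) by (simp del: comp_apply)
next
  case (Cons b q)
  let ?S = "subtopology X (supp b)" let ?V = "bd1 b"
  have q: "q \<noteq> []" using Cons.hyps(2) by (rule poset_path_from_to_nonempty)
  obtain r where r: "covers g s q r" "edge_covers g r b t" using Cons.prems(1) q by auto
  obtain r' where r': "covers g' s' q r'" "edge_covers g' r' b t'" using Cons.prems(2) q by auto
  have lt: "s < r" "r < t" "s' < r'" "r' < t'"
    using r r' covers_less by (auto simp: edge_covers_def)
  have C: "supp b \<in> C" "?V \<in> C" "bd0 b \<subseteq> supp b" "?V \<subseteq> supp b"
    using simplex_in_C[OF Cons.hyps(1)] by auto
  obtain \<delta> where \<delta>: "path_from_to (subtopology X ?V) (g r) (g' r') \<delta>"
    using exists_path_in_C[OF C(2)] r(2) r'(2) by (auto simp: edge_covers_def)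
  have IH: "path_homotopic X (g s) (g' r') (top_join (g \<circ> linear_path s r) \<delta>) (g' \<circ> linear_path s' r')"
    using Cons.IH[OF r(1) r'(1) _ _ _ _ _ \<delta>] Cons.prems lt by (auto simp del: comp_apply)
  have I: "s \<in> {0..1}" "r \<in> {0..1}" "t \<in> {0..1}" "s' \<in> {0..1}" "r' \<in> {0..1}" "t' \<in> {0..1}"
    using lt Cons.prems by auto
  \<comment> \<open>The rungs \<open>\<delta>\<close> and \<open>\<gamma>\<close> lie in
    \<open>supp b\<close> because the vertices of \<open>b\<close> do.\<close>
  have S: "path_from_to ?S (g r) (g t) (g \<circ> linear_path r t)"
      "path_from_to ?S (g' r') (g' t') (g' \<circ> linear_path r' t')"
      "path_from_to ?S (g r) (g' r') \<delta>" "path_from_to ?S (g t) (g' t') \<gamma>"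
    using r(2) r'(2) \<delta> Cons.prems(8) C lt I
    by (auto intro!: path_from_to_subpath g g' simp: edge_covers_def)
      (auto simp: path_from_to_subtopology)
  have square: "path_homotopic X (g r) (g' t') (top_join (g \<circ> linear_path r t) \<gamma>)
      (top_join \<delta> (g' \<circ> linear_path r' t'))"
    by (rule path_homotopic_in_C[OF C(1) path_from_to_join[OF S(1,4)] path_from_to_join[OF S(3,2)]])
  have X: "path_from_to X (g r) (g t) (g \<circ> linear_path r t)" "path_from_to X (g s) (g r) (g \<circ> linear_path s r)"
      "path_from_to X (g' r') (g' t') (g' \<circ> linear_path r' t')"
      "path_from_to X (g r) (g' r') \<delta>" "path_from_to X (g t) (g' t') \<gamma>"
    using S pathin_compose_interval[OF g path_from_to_linear_path[OF I(1,2)]]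
    by (auto simp: path_from_to_subtopology)
  have "path_homotopic X (g s) (g' t') (top_join (g \<circ> linear_path s t) \<gamma>)
      (top_join (top_join (g \<circ> linear_path s r) (g \<circ> linear_path r t)) \<gamma>)"
    using path_homotopic_sym[OF path_homotopic_subpaths[OF g I(1-3)]] X(5)
    by (intro path_homotopic_join) (simp_all add: path_homotopic_refl)
  also have "path_homotopic X (g s) (g' t') \<dots>
      (top_join (g \<circ> linear_path s r) (top_join (g \<circ> linear_path r t) \<gamma>))"
    by (rule path_homotopic_assoc[OF X(2,1,5)])
  also have "path_homotopic X (g s) (g' t') \<dots>
      (top_join (g \<circ> linear_path s r) (top_join \<delta> (g' \<circ> linear_path r' t')))"
    by (rule path_homotopic_join[OF path_homotopic_refl[THEN iffD2, OF X(2)] square])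
  also have "path_homotopic X (g s) (g' t') \<dots>
      (top_join (top_join (g \<circ> linear_path s r) \<delta>) (g' \<circ> linear_path r' t'))"
    by (rule path_homotopic_sym[OF path_homotopic_assoc[OF X(2,4,3)]])
  also have "path_homotopic X (g s) (g' t') \<dots>
      (top_join (g' \<circ> linear_path s' r') (g' \<circ> linear_path r' t'))"
    using IH X(3) by (intro path_homotopic_join) (simp_all add: path_homotopic_refl)
  also have "path_homotopic X (g s) (g' t') \<dots> (g' \<circ> linear_path s' t')"
    using path_homotopic_subpaths[OF g' I(4-6)] Cons.prems(7) by simp
  finally show ?case .
qed

lemma curves_with_common_cover_homotopic:
  assumes "path_from_to X x y g" "path_from_to X x y h"
    and "poset_path_from_to C_order U V q" "covers g 0 q 1" "covers h 0 q 1"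
  shows "path_homotopic X x y g h"
proof -
  have gh: "pathin X g" "pathin X h" "g 0 = x" "g 1 = y" "h 0 = x" "h 1 = y"
    using assms(1,2) by (auto simp: path_from_to_def)
  have "y \<in> V" using covers_end[OF assms(4)] assms(3) gh by (simp add: poset_path_from_to_def)
  moreover have "y \<in> topspace X" using path_finish_in_topspace[OF gh(1)] gh by simp
  \<comment> \<open>The closing rung is constant, since both curves end at \<open>y\<close>.\<close>
  ultimately have "path_from_to (subtopology X V) (g 1) (h 1) (\<lambda>_. y)"
    using gh by (simp add: path_from_to_def)
  from curves_with_common_cover[OF gh(1,2) assms(3-5) _ _ _ _ _ this]
  have "path_homotopic X x y (top_join g (\<lambda>_. y)) h" using gh by simp
  then show ?thesis
    using path_homotopic_sym[OF path_homotopic_const_right[OF assms(1)]] path_homotopic_trans by metis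
qed

text \<open>Points are chosen in the vertices and joined inside the supports. This gives
  surjectivity of the identification and supplies the auxiliary curves of
  \<open>curves_with_homotopic_covers\<close>.\<close>

lemma exists_covered_curve:
  assumes "poset_path_from_to C_order U V q" "x \<in> U" "y \<in> V"
  shows "\<exists>g. path_from_to X x y g \<and> covers g 0 q 1"
  using assms
proof (induction arbitrary: y rule: poset_path_induct)
  case (single b)
  note C = simplex_in_C[OF single.hyps(1)]
  obtain g where "path_from_to (subtopology X (supp b)) x y g"
    using exists_path_in_C[OF C(1), of x y] single C by blast
  then have "path_from_to X x y g" "g ` {0..1} \<subseteq> supp b"
    by (simp_all add: path_from_to_subtopology)
  then have "path_from_to X x y g \<and> edge_covers g 0 b 1"
    using single by (simp add: edge_covers_def path_from_to_def)
  then show ?case by auto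
next
  case (Cons b q)
  note C = simplex_in_C[OF Cons.hyps(1)]
  obtain z where z: "z \<in> bd1 b"
    using C_nonempty[OF C(3)] by blast
  obtain g1 where g1: "path_from_to X x z g1" "covers g1 0 q 1"
    using Cons.IH[OF Cons.prems(1) z] by blast
  obtain g2 where g2: "path_from_to (subtopology X (supp b)) z y g2"
    using exists_path_in_C[OF C(1), of z y] z Cons.prems C by blast
  then have "path_from_to X z y g2" "g2 ` {0..1} \<subseteq> supp b"
    by (simp_all add: path_from_to_subtopology)
  then have "path_from_to X z y g2" "covers g2 0 [b] 1"
    using z Cons.prems by (simp_all add: edge_covers_def path_from_to_def)
  then have "path_from_to X x y (top_join g1 g2)" "covers (top_join g1 g2) 0 ([b] @ q) 1"
    using g1 path_from_to_join[OF g1(1), of y g2] covers_join[of g1 q g2 "[b]"]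
    by (auto simp: path_from_to_def[of X x z] path_from_to_def[of X z y] simp del: append.simps covers.simps)
  then show ?case by auto
qed

text \<open>The edge with the ends of \<open>face1 c\<close> and support \<open>supp2 c\<close>
  covers whatever \<open>face1 c\<close> covers and whatever \<open>face2 c\<close> followed by
  \<open>face0 c\<close> covers.\<close>

lemma elementary_deformation_common_cover:
  assumes "elementary_deformation C_order q q'" "poset_path_from_to C_order U V q"
    and "covers g 0 q 1" "covers h 0 q' 1"
  shows "\<exists>p. poset_path_from_to C_order U V p \<and> covers g 0 p 1 \<and> covers h 0 p 1"
proof -
  obtain r s c where c: "is_simplex2 C_order c" and q: "q = r @ [face1 c] @ s" "q' = r @ [face0 c, face2 c] @ s"
    using assms(1) by (auto simp: elementary_deformation_def)
  let ?e = "Simplex1 (supp2 c) (bd0 (face1 c)) (bd1 (face1 c))"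
  have c': "is_simplex1 C_order (face1 c)" "(supp (face1 c), supp2 c) \<in> C_order"
    "(supp (face0 c), supp2 c) \<in> C_order" "(supp (face2 c), supp2 c) \<in> C_order"
    "bd0 (face1 c) = bd0 (face0 c)" "bd0 (face2 c) = bd1 (face0 c)" "bd1 (face2 c) = bd1 (face1 c)"
    using c by (auto simp: is_simplex2_def)
  have "poset_path_from_to C_order U V (r @ [?e] @ s)"
    using assms(2) unfolding q
    by (rule poset_path_from_to_replace)
      (use c' in \<open>auto simp: poset_path_from_to_single is_simplex1_def mem_inclusion_order\<close>)
  moreover have "covers g 0 (r @ [?e] @ s) 1"
    using assms(3) unfolding q
    by (rule covers_replace) (use c' in \<open>auto simp: edge_covers_def mem_inclusion_order\<close>)
  moreover have "covers h 0 (r @ [?e] @ s) 1"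
    using assms(4) unfolding q
  proof (rule covers_replace)
    fix u v assume "covers h u [face0 c, face2 c] v"
    then obtain w where "edge_covers h u (face2 c) w" "edge_covers h w (face0 c) v" by auto
    moreover from this have "{u..v} = {u..w} \<union> {w..v}" by (auto simp: edge_covers_def)
    ultimately show "covers h u [?e] v"
      using c' by (auto simp: edge_covers_def mem_inclusion_order image_Un)
  qed auto
  ultimately show ?thesis by blast
qed

text \<open>A deformed path may fail to cover the given curve, so each intermediate path gets a
  curve of its own with the same ends.\<close>

lemma curves_with_homotopic_covers:
  assumes "poset_homotopic C_order q q'" and q: "poset_path_from_to C_order U V q"
    and g: "path_from_to X x y g" "covers g 0 q 1" and h: "path_from_to X x y h" "covers h 0 q' 1"
  shows "path_homotopic X x y g h"
  using assms(1) h
proof (induction arbitrary: h rule: equivclp_induct)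
  case base
  then show ?case using curves_with_common_cover_homotopic[OF g(1) _ q g(2)] by blast
next
  case (step r r')
  have r: "poset_path_from_to C_order U V r"
    using poset_homotopic_from_to[OF step.hyps(1), of U V] q by blast
  have r': "poset_path_from_to C_order U V r'"
    using step.hyps(2) elementary_deformation_from_to[of C_order r r' U V]
      elementary_deformation_from_to[of C_order r' r U V] r by blast
  have "x \<in> U" "y \<in> V"
    using covers_start[OF g(2)] covers_end[OF g(2)] g(1) q by (auto simp: poset_path_from_to_def path_from_to_def)
  then obtain k where k: "path_from_to X x y k" "covers k 0 r 1"
    using exists_covered_curve[OF r] by blast
  have "\<exists>p. poset_path_from_to C_order U V p \<and> covers k 0 p 1 \<and> covers h 0 p 1"
    using step.hyps(2)
  proof
    assume "elementary_deformation C_order r r'"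
    from elementary_deformation_common_cover[OF this r k(2) step.prems(2)] show ?thesis .
  next
    assume "elementary_deformation C_order r' r"
    from elementary_deformation_common_cover[OF this r' step.prems(2) k(2)] show ?thesis by blast
  qed
  then have "path_homotopic X x y k h"
    using curves_with_common_cover_homotopic[OF k(1) step.prems(1)] by blast
  with step.IH[OF k] show ?case by (rule path_homotopic_trans)
qed

section \<open>The identification of the two fundamental groups\<close>

lemma base_identification_class:
  assumes "continuous_map M X f" "g \<in> top_loops M m" "U \<in> C" "f m \<in> U"
    and "poset_path_from_to C_order U U q" "covers (f \<circ> g) 0 q 1"
  shows "base_identification C U f (top_homotopy_class M m g) = poset_homotopy_class C_order q"
proof -
  \<comment> \<open>Approximations of homotopic curves are homotopic, so the union defining
    \<open>base_identification\<close> is a single class.\<close>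
  have eq: "poset_homotopy_class C_order q' = poset_homotopy_class C_order q"
    if "h \<in> top_homotopy_class M m g" "q' \<in> poset_loops C_order U" "approximates q' (f \<circ> h)" for h q'
  proof -
    have q': "poset_path_from_to C_order U U q'" "covers (f \<circ> h) 0 q' 1"
      using that(2,3) approximates_iff_covers[of q' "f \<circ> h"] poset_path_from_to_nonempty[of C_order U U q']
      by (auto simp: poset_loops_def)
    have "path_homotopic X (f m) (f m) (f \<circ> g) (f \<circ> h)"
      using that(1) assms(1) by (auto simp: mem_top_homotopy_class intro: path_homotopic_map)
    from covering_paths_of_homotopic_curves[OF this assms(3,3,4,4,5,6) q']
    show ?thesis by (simp add: poset_homotopy_class_eq equivclp_sym)
  qed
  have "g \<in> top_homotopy_class M m g"
    using assms(2) by (simp add: mem_top_homotopy_class path_homotopic_refl mem_top_loops)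
  moreover have "q \<in> {q \<in> poset_loops C_order U. approximates q (f \<circ> g)}"
    using assms(5,6) approximates_iff_covers[of q] covers_nonempty[OF assms(6)] by (simp add: poset_loops_def)
  ultimately show ?thesis
    using eq unfolding base_identification_def by blast
qed

lemma exists_covering_loop:
  assumes "path_from_to X x x g" "U \<in> C" "x \<in> U"
  obtains q where "poset_path_from_to C_order U U q" "covers g 0 q 1"
  using exists_covering_path[of g 0 1 U U] assms by (auto simp: path_from_to_def)

text \<open>Multiplicativity comes from \<open>covers_join\<close>, injectivity from
  \<open>curves_with_homotopic_covers\<close> and surjectivity from
  \<open>exists_covered_curve\<close>.\<close>

theorem base_identification_iso:
  assumes f: "homeomorphic_map M X f" and "U \<in> C" "f m \<in> U" "m \<in> topspace M"
  shows "base_identification C U f \<in> iso (top_pi1 M m) (poset_pi1 C_order U)"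
proof -
  obtain f' where f': "continuous_map M X f" "continuous_map X M f'" "\<And>x. x \<in> topspace M \<Longrightarrow> f' (f x) = x"
      "\<And>x. x \<in> topspace X \<Longrightarrow> f (f' x) = x"
    using f by (auto simp: homeomorphic_map_maps homeomorphic_maps_def)
  have loop: "path_from_to X (f m) (f m) (f \<circ> g)" if "g \<in> top_loops M m" for g
    using that f'(1) pathin_compose by (auto simp: top_loops_def path_from_to_def)
  let ?I = "base_identification C U f"
  have I_class: "?I (top_homotopy_class M m g) = poset_homotopy_class C_order q"
    if "g \<in> top_loops M m" "poset_path_from_to C_order U U q" "covers (f \<circ> g) 0 q 1" for g q
    using base_identification_class[OF f'(1)] that assms by blast
  have cover: "\<exists>q. poset_path_from_to C_order U U q \<and> covers (f \<circ> g) 0 q 1" if "g \<in> top_loops M m" for g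
    using exists_covering_loop[OF loop[OF that] assms(2,3)] by blast
  have "?I \<in> hom (top_pi1 M m) (poset_pi1 C_order U)"
  proof (rule homI)
    fix u assume "u \<in> carrier (top_pi1 M m)"
    then obtain g where g: "g \<in> top_loops M m" "u = top_homotopy_class M m g"
      by (auto simp: carrier_top_pi1)
    with cover[OF g(1)] show "?I u \<in> carrier (poset_pi1 C_order U)"
      by (auto simp: I_class carrier_poset_pi1 poset_loops_def)
    fix v assume "v \<in> carrier (top_pi1 M m)"
    then obtain h where h: "h \<in> top_loops M m" "v = top_homotopy_class M m h"
      by (auto simp: carrier_top_pi1)
    obtain p where p: "poset_path_from_to C_order U U p" "covers (f \<circ> g) 0 p 1" using cover[OF g(1)] by blast
    obtain q where q: "poset_path_from_to C_order U U q" "covers (f \<circ> h) 0 q 1" using cover[OF h(1)] by blast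
    \<comment> \<open>The product traverses \<open>h\<close> first; accordingly \<open>q\<close>
      stands at the right end of the list.\<close>
    have "covers (top_join (f \<circ> h) (f \<circ> g)) 0 (p @ q) 1"
      using loop[OF g(1)] loop[OF h(1)] by (intro covers_join p q) (auto simp: path_from_to_def)
    then have "?I (top_homotopy_class M m (top_join h g)) = poset_homotopy_class C_order (p @ q)"
      using poset_path_from_to_appendI[OF q(1) p(1)]
      by (intro I_class join_top_loops g h) (simp_all add: top_join_compose)
    then show "?I (u \<otimes>\<^bsub>top_pi1 M m\<^esub> v) = ?I u \<otimes>\<^bsub>poset_pi1 C_order U\<^esub> ?I v"
      using g h p q by (simp add: top_pi1_mult I_class[OF g(1) p] I_class[OF h(1) q] poset_pi1_mult poset_loops_def)
  qed
  moreover have "inj_on ?I (carrier (top_pi1 M m))"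
  proof (rule inj_onI)
    fix u v assume "u \<in> carrier (top_pi1 M m)" "v \<in> carrier (top_pi1 M m)" and eq: "?I u = ?I v"
    then obtain g h where gh: "g \<in> top_loops M m" "u = top_homotopy_class M m g"
        "h \<in> top_loops M m" "v = top_homotopy_class M m h"
      by (auto simp: carrier_top_pi1)
    obtain p where p: "poset_path_from_to C_order U U p" "covers (f \<circ> g) 0 p 1" using cover[OF gh(1)] by blast
    obtain q where q: "poset_path_from_to C_order U U q" "covers (f \<circ> h) 0 q 1" using cover[OF gh(3)] by blast
    have "poset_homotopic C_order p q"
      using eq by (simp add: gh(2,4) I_class[OF gh(1) p] I_class[OF gh(3) q] poset_homotopy_class_eq)
    then have "path_homotopic X (f m) (f m) (f \<circ> g) (f \<circ> h)"
      using curves_with_homotopic_covers p q loop gh by blast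
    from path_homotopic_map[OF this f'(2)]
    have 1: "path_homotopic M m m (f' \<circ> (f \<circ> g)) (f' \<circ> (f \<circ> h))"
      using f'(3) assms(4) by simp
    \<comment> \<open>\<open>f'\<close> inverts \<open>f\<close> on the space only, and
      \<open>k\<close> is controlled on the unit interval only; hence a homotopy in place of an
      equality.\<close>
    have "path_homotopic M m m k (f' \<circ> (f \<circ> k))" if "k \<in> top_loops M m" for k
    proof (rule path_homotopic_eq)
      show "k t = (f' \<circ> (f \<circ> k)) t" if "t \<in> {0..1}" for t
        using path_image_subset_topspace[of M k] \<open>k \<in> _\<close> that f'(3)[of "k t"]
        by (auto simp: top_loops_def Pi_iff)
    qed (use that in \<open>simp add: mem_top_loops\<close>)
    with gh 1 have "path_homotopic M m m g h"
      by (meson path_homotopic_sym path_homotopic_trans)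
    then show "u = v" using gh by (simp add: top_homotopy_class_eq)
  qed
  moreover have "?I ` carrier (top_pi1 M m) = carrier (poset_pi1 C_order U)"
  proof (rule equalityI)
    show "?I ` carrier (top_pi1 M m) \<subseteq> carrier (poset_pi1 C_order U)"
      using calculation(1) by (auto simp: hom_def)
    show "carrier (poset_pi1 C_order U) \<subseteq> ?I ` carrier (top_pi1 M m)"
    proof
      fix u assume "u \<in> carrier (poset_pi1 C_order U)"
      then obtain q where q: "poset_path_from_to C_order U U q" "u = poset_homotopy_class C_order q"
        by (auto simp: carrier_poset_pi1 poset_loops_def)
      obtain k where k: "path_from_to X (f m) (f m) k" "covers k 0 q 1"
        using exists_covered_curve[OF q(1) assms(3,3)] by blast
      have "f' \<circ> k \<in> top_loops M m"
        using k(1) f' assms(4) by (auto simp: top_loops_def path_from_to_def intro: pathin_compose)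
      moreover have "f (f' (k t)) = k t" if "t \<in> {0..1}" for t
        using path_image_subset_topspace[of X k] k(1) that
        by (intro f'(4)) (auto simp: path_from_to_def Pi_iff)
      \<comment> \<open>The parameter is unchanged; covering depends only on the values in the unit
        interval.\<close>
      then have "covers (f \<circ> (f' \<circ> k)) 0 q 1"
        using covers_affine[OF k(2), of 1 "f \<circ> (f' \<circ> k)" 0] by simp
      ultimately show "u \<in> ?I ` carrier (top_pi1 M m)"
        using I_class[OF _ q(1)] q(2) by (auto simp: carrier_top_pi1)
    qed
  qed
  ultimately show ?thesis by (simp add: iso_def bij_betw_def)
qed

text \<open>Turns arcwise connectedness of the fibre into the connectedness hypothesis of
  \<open>exact_at_base\<close>.\<close>

lemma exists_path_between:
  assumes "path_connected_space X" "V \<in> C" "V \<noteq> {}" "U \<in> C" "U \<noteq> {}"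
  shows "\<exists>q. poset_path_from_to C_order V U q"
proof -
  obtain x y where xy: "x \<in> V" "y \<in> U" using assms by blast
  then have "x \<in> topspace X" "y \<in> topspace X"
    using assms C_openin openin_subset by blast+
  then obtain g where "pathin X g" "g 0 = x" "g 1 = y"
    using assms(1) by (auto simp: path_connected_space_def)
  then show ?thesis using exists_covering_path[of g 0 1 V U] assms xy by auto
qed

end

section \<open>The exact sequence\<close>

text \<open>An isomorphism in front does not change the image, which is all that exactness sees of
  the first group.\<close>

lemma exact_at_precompose_iso:
  assumes "exact_at H I L f g" "h \<in> iso G H" "group G"
  shows "exact_at G I L (f \<circ> h) g"
proof -
  interpret f: group_hom H I f using assms(1) by (simp add: exact_at_def)
  have "h \<in> hom G H" "h ` carrier G = carrier H"
    using assms(2) by (auto simp: iso_def bij_betw_def)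
  then have "group_hom G I (f \<circ> h)"
    using assms(3) f.homh by (auto simp: group_hom_def group_hom_axioms_def intro: hom_compose f.H.is_group)
  moreover have "(f \<circ> h) ` carrier G = f ` carrier H"
    using \<open>h ` carrier G = carrier H\<close> by (simp only: image_comp[symmetric])
  ultimately show ?thesis using assms(1) by (simp add: exact_at_def)
qed

theorem corollary4p5:
  fixes K :: "'k rel" and X :: "'x set" and p :: "'x \<Rightarrow> 'k"
    and T :: "'k \<Rightarrow> 'x topology" and J :: "'k \<Rightarrow> 'k \<Rightarrow> 'x \<Rightarrow> 'x"
    and B :: "'k \<Rightarrow> 'x set set" and M :: "'m topology"
    and a :: 'k and U :: "'x set" and \<phi> :: "'m \<Rightarrow> 'x" and m :: 'm
  assumes "poset_net_bundle K X p T J B"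
    and "pathwise_connected_poset K"
    and "\<And>c. c \<in> Field K \<Longrightarrow> T c homeomorphic_space M"
    and "path_connected_space M" and "Hausdorff_space M"
    and "locally_simply_connected_space M"
    and "\<And>c V. c \<in> Field K \<Longrightarrow> V \<in> B c \<Longrightarrow> simply_connected_space (subtopology (T c) V)"
    and "a \<in> Field K" and "U \<in> B a"
    and "homeomorphic_map M (T a) \<phi>" and "m \<in> topspace M" and "\<phi> m \<in> U"
  shows "base_identification (B a) U \<phi> \<in> iso (top_pi1 M m) (poset_pi1 (inclusion_order (B a)) U) \<and>
    exact_at (top_pi1 M m) (poset_pi1 (bundle_order K J B) (a, U)) (poset_pi1 K a)
      (fibre_pi1_map K J B a U \<phi>) (poset_pi1_map K fst) \<and>
    exact_at (poset_pi1 (bundle_order K J B) (a, U)) (poset_pi1 K a) (singleton_group ())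
      (poset_pi1_map K fst) (\<lambda>_. ())"
proof -
  interpret poset_net_bundle K X p T J B by fact
  interpret fib: simply_connected_base "T a" "B a"
  proof
    show "openin (T a) V" "V \<noteq> {}" if "V \<in> B a" for V
      using B_open[OF \<open>a \<in> Field K\<close> that] by auto
    show "\<exists>V \<in> B a. x \<in> V \<and> V \<subseteq> W" if "openin (T a) W" "x \<in> W" for W x
      using B_base[OF \<open>a \<in> Field K\<close> that] .
    show "simply_connected_space (subtopology (T a) V)" if "V \<in> B a" for V
      using assms(7)[OF \<open>a \<in> Field K\<close> that] .
  qed
  have iso: "base_identification (B a) U \<phi> \<in> iso (top_pi1 M m) (poset_pi1 (inclusion_order (B a)) U)"
    using fib.base_identification_iso[OF assms(10,9,12,11)] .
  have "path_connected_space (T a)"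
    using assms(3,4,8) homeomorphic_path_connected_space by blast
  then have "\<exists>F. poset_path_from_to (inclusion_order (B a)) V U F" if "V \<in> B a" for V
    using fib.exists_path_between fib.C_nonempty that \<open>U \<in> B a\<close> by blast
  with iso exact_at_total_space[OF assms(8,9)] exact_at_base[OF assms(8,9)] group_top_pi1[OF assms(11)]
  show ?thesis
    by (auto simp: fibre_pi1_map_def intro: exact_at_precompose_iso)
qed

end
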